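(* Let $m=(m_1,m_2,m_3)$ be a triple of positive integers and let $x_1,x_2>0$. The jump rules of the Multiline coupe process define a continuous-time Markov chain $\Omega^C_m$ on the set of multiline queues of type $m$ in which the stationary weight of a configuration $\mathcal Q$ is $$w(\mathcal Q)=x_1^{m_3-k}\,x_2^{k},$$ where $k$ is the number of covered 3's in $\mathcal Q$. Moreover, this Markov chain lumps, via the bully-path projection $B$, to the inhomogeneous multispecies exclusion process (TASEP) on $\Omega_m$.
   Context: Let $N=m_1+m_2+m_3$. Columns (sites) are indexed by $\mathbb Z/N\mathbb Z$, and "left"/"right" are cyclic. **Exclusion process.** $\Omega_m$ is the set of words $\pi=(\pi_1,\dots,\pi_N)\in\{1,2,3\}^N$ with exactly $m_j$ letters equal to $j$. The inhomogeneous multispecies exclusion process on $\Omega_m$ is the continuous-time Markov chain in which, for each $i\in\mathbb Z/N\mathbb Z$, if $\pi_i=a$, $\pi_{i+1}=b$ and $a>b$, then $ab\to ba$ at rate $x_b$ (the particle $b$ jumps to the left). **Multiline queues.** These are the arrays $\mathcal Q=(\mathcal Q_{r,i})$, $r\in\{1,2\}$, $i\in\mathbb Z/N\mathbb Z$, with entries in $\{\circ,\bullet\}$ ($\circ$ = vacant, $\bullet$ = occupied), such that row 1 (the top row) has exactly $m_1$ $\bullet$'s and row 2 has exactly $m_1+m_2$ $\bullet$'s. **Bully-path projection $B$.** All $\bullet$'s in row 1 have class 1. Process the $\bullet$'s of row 1 one after another in any order: for a $\bullet$ at $(1,i)$, find the first column $i'$ in the cyclic sequence $i,i+1,\dots$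 such that $(2,i')$ contains a not yet classified $\bullet$, and classify that $\bullet$ as class 1. The bully path of this particle goes from $(1,i)$ to $(2,i)$ and then through $(2,i+1),\dots,(2,i')$. The remaining $m_2$ $\bullet$'s of row 2 get class 2, and the $\circ$'s of row 2 get class 3. $B(\mathcal Q)_i$ is the class at $(2,i)$, so $B(\mathcal Q)\in\Omega_m$. The result, and the set of $\circ$'s in row 2 traversed by bully paths, do not depend on the order. **Covered 3's.** A letter $B(\mathcal Q)_i=3$ is covered if some bully path passes through the $\circ$ at $(2,i)$ (including the case where a bully path starts directly above at $(1,i)$). **Coupes.** Cut the circular word $B(\mathcal Q)$ to the right of every 2 not followed by a 2 and to the right of every 1 not followed by a 1. Each resulting subword, called a coupe, consists of a (possibly zero) number of 3's followed by a positive number of 1's, or by a positive number of 2's. In a coupe, the position of the leftmost 1 (or 2) is the front seat, and the position of the rightmost letter is the back seat. A front or back seat at column $i$ is occupied if $\mathcal Q_{1,i}=\bullet$ and vacant if $\mathcal Q_{1,i}=\circ$. The partition of the word into coupes partitions the columns of $\mathcal Q$ correspondingly. **Multiline coupe process $\Omega^C_m$.** The state space is the set of multiline queues of type $m$. The particles that can jump are exactly the front seat particles of the coupes, except that the front seat of a coupe consisting only of 2's cannot jump. A front seat particle of class 1 jumps at rate $x_1$ and one of class 2 jumps at rate $x_2$. When the front seat particle at column $i$ jumps, the configuration changes as follows. - Regular jump: if the front seat is a 1 and is occupied, then in each of rows 1 and 2 the $\bullet$ at column $i$ moves to column $i-1$ if that position (in the same row) is vacant; otherwise it stays. - Pulling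 jump: if the front seat (a 1 or a 2) is vacant, then the $\bullet$ at $(2,i)$ moves to $(2,i-1)$, and in addition all $\bullet$'s in row 1 that lie to the right of column $i$ but in the same coupe move one step to the left. If this front seat is also the back seat of its coupe, then instead all $\bullet$'s in row 1 in the columns of the next coupe to the right move one step to the left. **Stationary weights.** $w$ is a stationary weight if for every state $\tau$: $\sum_{\tau'\ne\tau}\mathrm{rate}(\tau'\to\tau)\,w(\tau')=\sum_{\tau'\neq\tau}\mathrm{rate}(\tau\to\tau')\,w(\tau)$; stationary weights are unique up to a common scalar factor. **Lumping.** The chain lumps via $B$ to the chain on $\Omega_m$ if for every multiline queue $\mathcal Q$ and every $\pi'\in\Omega_m$ with $\pi'\neq B(\mathcal Q)$, $\sum_{\mathcal Q':\,B(\mathcal Q')=\pi'}\mathrm{rate}(\mathcal Q\to\mathcal Q')=\mathrm{rate}(B(\mathcal Q)\to\pi')$. *)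

theory Defs
  imports Complex_Main
begin

text \<open>
  Sites (columns) are the residues \<open>0, \<dots>, N - 1\<close>, with cyclic neighbours. A word is a list of
  length \<open>N\<close> over the letters 1, 2, 3.
\<close>

definition right_of :: "nat \<Rightarrow> nat \<Rightarrow> nat" where
  "right_of N i = (i + 1) mod N"

definition left_of :: "nat \<Rightarrow> nat \<Rightarrow> nat" where
  "left_of N i = (i + (N - 1)) mod N"


section \<open>Finite continuous-time Markov chains\<close>

text \<open>
  A chain on \<open>S\<close> is given by its rates \<open>rate s t\<close> for going from \<open>s\<close> to \<open>t\<close>. The values
  \<open>rate s s\<close> are irrelevant.
\<close>

definition markov_chain :: "'s set \<Rightarrow> ('s \<Rightarrow> 's \<Rightarrow> real) \<Rightarrow> bool" where
  "markov_chain S rate \<longleftrightarrow>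
     finite S \<and> S \<noteq> {} \<and>
     (\<forall>s\<in>S. \<forall>t. 0 \<le> rate s t) \<and>
     (\<forall>s\<in>S. \<forall>t. t \<notin> S \<longrightarrow> rate s t = 0)"

definition stationary_weight :: "'s set \<Rightarrow> ('s \<Rightarrow> 's \<Rightarrow> real) \<Rightarrow> ('s \<Rightarrow> real) \<Rightarrow> bool" where
  "stationary_weight S rate w \<longleftrightarrow>
     (\<forall>t\<in>S. (\<Sum>s\<in>S - {t}. rate s t * w s) = (\<Sum>s\<in>S - {t}. rate t s * w t))"

definition lumps ::
  "'s set \<Rightarrow> ('s \<Rightarrow> 's \<Rightarrow> real) \<Rightarrow> ('s \<Rightarrow> 't) \<Rightarrow> 't set \<Rightarrow> ('t \<Rightarrow> 't \<Rightarrow> real) \<Rightarrow> bool" where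
  "lumps S rate f T rate' \<longleftrightarrow>
     f ` S \<subseteq> T \<and>
     (\<forall>s\<in>S. \<forall>t\<in>T. t \<noteq> f s \<longrightarrow> (\<Sum>s' | s' \<in> S \<and> f s' = t. rate s s') = rate' (f s) t)"


section \<open>The inhomogeneous exclusion process\<close>

definition words :: "nat \<Rightarrow> nat \<Rightarrow> nat \<Rightarrow> nat list set" where
  "words m1 m2 m3 =
     {p. length p = m1 + m2 + m3 \<and> set p \<subseteq> {1, 2, 3} \<and>
         count_list p 1 = m1 \<and> count_list p 2 = m2 \<and> count_list p 3 = m3}"

definition swap_right :: "nat \<Rightarrow> nat list \<Rightarrow> nat list" where
  "swap_right i p = (let j = right_of (length p) i in p[i := p ! j, j := p ! i])"

definition exclusion_rate :: "(nat \<Rightarrow> real) \<Rightarrow> nat list \<Rightarrow> nat list \<Rightarrow> real" where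
  "exclusion_rate x p p' =
     (\<Sum>i | i < length p \<and> p ! i > p ! right_of (length p) i \<and> swap_right i p = p'.
        x (p ! right_of (length p) i))"


section \<open>Multiline queues and the bully-path projection\<close>

text \<open>
  A two-row array of occupied and vacant positions is represented by the pair (row 1, row 2) of
  its sets of occupied columns.
\<close>

type_synonym mlq = "nat set \<times> nat set"

definition multiline_queues :: "nat \<Rightarrow> nat \<Rightarrow> nat \<Rightarrow> mlq set" where
  "multiline_queues m1 m2 m3 =
     {(R1, R2). R1 \<subseteq> {..<m1 + m2 + m3} \<and> R2 \<subseteq> {..<m1 + m2 + m3} \<and>
                card R1 = m1 \<and> card R2 = m1 + m2}"

text \<open>
  The state of the bully-path procedure is a pair: the columns of the particles in row 2 already
  classified as class 1, and the columns whose row 2 position lies on some bully path so far.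
  Processing the particle at \<open>(1, i)\<close> makes its path run through columns \<open>i, \<dots>, i + d\<close> of row 2.
\<close>

definition bully_step ::
  "nat \<Rightarrow> nat set \<Rightarrow> nat \<Rightarrow> nat set \<times> nat set \<Rightarrow> nat set \<times> nat set" where
  "bully_step N R2 i = (\<lambda>(C, V).
     let d = (LEAST d. (i + d) mod N \<in> R2 - C)
     in (insert ((i + d) mod N) C, V \<union> (\<lambda>e. (i + e) mod N) ` {..d}))"

text \<open>
  The particles of row 1 are processed by increasing column. The resulting class 1 columns, and
  the vacant positions of row 2 that are traversed, do not depend on the order.
\<close>

definition bully_paths :: "nat \<Rightarrow> mlq \<Rightarrow> nat set \<times> nat set" where
  "bully_paths N Q = fold (bully_step N (snd Q)) (sorted_list_of_set (fst Q)) ({}, {})"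

definition first_class :: "nat \<Rightarrow> mlq \<Rightarrow> nat set" where
  "first_class N Q = fst (bully_paths N Q)"

definition traversed :: "nat \<Rightarrow> mlq \<Rightarrow> nat set" where
  "traversed N Q = snd (bully_paths N Q)"

definition bully_projection :: "nat \<Rightarrow> mlq \<Rightarrow> nat list" where
  "bully_projection N Q =
     map (\<lambda>i. if i \<in> first_class N Q then 1 else if i \<in> snd Q then 2 else 3) [0..<N]"

definition covered_threes :: "nat \<Rightarrow> mlq \<Rightarrow> nat set" where
  "covered_threes N Q = {i. i < N \<and> bully_projection N Q ! i = 3 \<and> i \<in> traversed N Q}"


section \<open>Coupes\<close>

definition cut_right :: "nat list \<Rightarrow> nat \<Rightarrow> bool" where
  "cut_right p i \<longleftrightarrow>
     (p ! i = 2 \<and> p ! right_of (length p) i \<noteq> 2) \<or>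
     (p ! i = 1 \<and> p ! right_of (length p) i \<noteq> 1)"

text \<open>A coupe is represented by the list of its columns from left to right.\<close>

definition coupe_from :: "nat list \<Rightarrow> nat \<Rightarrow> nat list" where
  "coupe_from p s =
     (let d = (LEAST d. cut_right p ((s + d) mod length p))
      in map (\<lambda>e. (s + e) mod length p) [0..<Suc d])"

definition coupes :: "nat list \<Rightarrow> nat list set" where
  "coupes p = coupe_from p ` {s. s < length p \<and> cut_right p (left_of (length p) s)}"

text \<open>The columns of the coupe that do not carry a 3, that is, from the front to the back seat.\<close>

definition seats :: "nat list \<Rightarrow> nat list \<Rightarrow> nat list" where
  "seats p c = dropWhile (\<lambda>i. p ! i = 3) c"

definition front_seat :: "nat list \<Rightarrow> nat list \<Rightarrow> nat" where
  "front_seat p c = hd (seats p c)"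

definition back_seat :: "nat list \<Rightarrow> nat" where
  "back_seat c = last c"

definition next_coupe :: "nat list \<Rightarrow> nat list \<Rightarrow> nat list" where
  "next_coupe p c = coupe_from p (right_of (length p) (back_seat c))"

definition can_jump :: "nat list \<Rightarrow> nat list \<Rightarrow> bool" where
  "can_jump p c \<longleftrightarrow> \<not> (\<forall>i\<in>set c. p ! i = 2)"


section \<open>The multiline coupe process\<close>

definition hop_left :: "nat \<Rightarrow> nat \<Rightarrow> nat set \<Rightarrow> nat set" where
  "hop_left N i R = (if left_of N i \<in> R then R else insert (left_of N i) (R - {i}))"

definition shift_left :: "nat \<Rightarrow> nat set \<Rightarrow> nat set \<Rightarrow> nat set" where
  "shift_left N D R = (R - D) \<union> left_of N ` (R \<inter> D)"

definition regular_jump :: "nat \<Rightarrow> nat \<Rightarrow> mlq \<Rightarrow> mlq" where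
  "regular_jump N i Q = (hop_left N i (fst Q), hop_left N i (snd Q))"

definition pulling_jump :: "nat \<Rightarrow> nat list \<Rightarrow> nat list \<Rightarrow> mlq \<Rightarrow> mlq" where
  "pulling_jump N p c Q =
     (let i = front_seat p c;
          D = (if i = back_seat c then set (next_coupe p c) else set (tl (seats p c)))
      in (shift_left N D (fst Q), insert (left_of N i) (snd Q - {i})))"

text \<open>
  A front seat of class 2 is always vacant: a particle directly below a particle of row 1 has
  class 1. So the second case is exactly that of a vacant front seat.
\<close>

definition coupe_jump :: "nat \<Rightarrow> nat list \<Rightarrow> mlq \<Rightarrow> mlq" where
  "coupe_jump N c Q =
     (let p = bully_projection N Q; i = front_seat p c
      in if p ! i = 1 \<and> i \<in> fst Q then regular_jump N i Q else pulling_jump N p c Q)"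

definition coupe_rate :: "nat \<Rightarrow> (nat \<Rightarrow> real) \<Rightarrow> mlq \<Rightarrow> mlq \<Rightarrow> real" where
  "coupe_rate N x Q Q' =
     (let p = bully_projection N Q
      in \<Sum>c | c \<in> coupes p \<and> can_jump p c \<and> coupe_jump N c Q = Q'. x (p ! front_seat p c))"

definition coupe_weight :: "nat \<Rightarrow> (nat \<Rightarrow> real) \<Rightarrow> nat \<Rightarrow> mlq \<Rightarrow> real" where
  "coupe_weight N x m3 Q =
     (let k = card (covered_threes N Q) in x 1 ^ (m3 - k) * x 2 ^ k)"

end

theory Submission
  imports Defs "HOL-Library.Multiset"
begin

text \<open>
  The bully paths of a queue are recorded by a \<^emph>\<open>flow\<close>: the number \<open>h k\<close> of paths that pass
  through \<open>(2, k)\<close>. Flows obey a local recursion around the circle, and the recursion has only one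
  solution because row 1 has fewer particles than row 2 (\<open>flow_unique\<close>). The word and the covered 3's
  can be read off from the flow: a particle of row 2 has class 1, and a 3 is covered, iff the flow
  is positive there. So the effect of a jump is found by writing down the new flow and checking the
  recursion. In each case the jump exchanges the front seat with the letter to its left (\<open>word_t\<close>).
  The front seats that can jump are the right ends of the descents of the word
  (\<open>bij_betw_front\<close>), and so the chain lumps to the exclusion process.

  For stationarity, every jump from \<open>Q\<close> to \<open>t\<close> is matched with a coupe of \<open>t\<close> that can jump: a
  regular jump with the coupe of the column that the front seat has moved to, a pulling
  jump with the coupe of the column that it has left. If the front seat has class \<open>a\<close> and the matched
  coupe has class \<open>c\<close>, then \<open>x a * w Q = x c * w t\<close>: a regular jump has \<open>a = c = 1\<close> and preserves the
  number of covered 3's, and a pulling jump loses a covered 3 if \<open>a = 1\<close> and gains one if \<open>c = 1\<close>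
  (\<open>card_covered_t\<close>). The queue \<open>Q\<close> and the jump can be recovered from \<open>t\<close> and the matched coupe: the
  jump was regular iff there is a particle of row 1 above the back seat of that coupe, and then
  all moves can be undone (\<open>jump_recovered\<close>). So the matching is an injective map from the
  finite set of all jumps to itself, hence a bijection, and the weight that enters \<open>t\<close> equals the
  weight that leaves \<open>t\<close> (\<open>stationary_weight_if_matching\<close>).

  Uniqueness amounts to irreducibility. In the presence of a positive stationary weight, a set
  that cannot be left cannot be entered either. It therefore suffices that one
  particular queue lies in every nonempty set that cannot be left. This holds for the queue over
  \<open>3\<dots>3 2\<dots>2 1\<dots>1\<close>, which is determined by its word (\<open>closed_contains_rigid_queue\<close>): the exclusion
  process can sort every word to \<open>1\<dots>1 2\<dots>2 3\<dots>3\<close>, and since this sorting can be reversed in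
  equilibrium, every word can be turned into every other.
\<close>

section \<open>Stationary weights of finite chains\<close>

lemma stationary_weight_iff:
  assumes "finite S"
  shows "stationary_weight S r w \<longleftrightarrow>
    (\<forall>t\<in>S. (\<Sum>s\<in>S. r s t * w s) = (\<Sum>s\<in>S. r t s * w t))"
proof -
  have "(\<Sum>s\<in>S. r s t * w s) = r t t * w t + (\<Sum>s\<in>S - {t}. r s t * w s)"
    "(\<Sum>s\<in>S. r t s * w t) = r t t * w t + (\<Sum>s\<in>S - {t}. r t s * w t)" if "t \<in> S" for t
    using assms that by (rule sum.remove)+
  then show ?thesis
    unfolding stationary_weight_def by simp
qed

text \<open>
  In equilibrium as much weight enters \<open>Z\<close> as leaves it. So if no transition leaves \<open>Z\<close>,
  none enters it, because all weights are positive.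
\<close>

lemma forward_closed_imp_backward_closed:
  fixes r :: "'s \<Rightarrow> 's \<Rightarrow> real"
  assumes chain: "markov_chain S r" and stat: "stationary_weight S r w"
    and pos: "\<And>s. s \<in> S \<Longrightarrow> 0 < w s"
    and Z: "Z \<subseteq> S" and closed: "\<And>s t. s \<in> Z \<Longrightarrow> t \<in> S - Z \<Longrightarrow> r s t = 0"
    and s: "s \<in> S - Z" and t: "t \<in> Z"
  shows "r s t = 0"
proof -
  have fin: "finite S" and nonneg: "\<And>s t. s \<in> S \<Longrightarrow> 0 \<le> r s t"
    using chain by (auto simp: markov_chain_def)
  have finZ: "finite Z" using Z fin finite_subset by blast
  have split: "sum f S = sum f Z + sum f (S - Z)" for f :: "'s \<Rightarrow> real"
    using fin Z by (simp add: sum.subset_diff)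
  have "(\<Sum>s\<in>S. r s t * w s) = (\<Sum>s\<in>S. r t s * w t)" if "t \<in> Z" for t
    using stat Z that by (auto simp: stationary_weight_iff[OF fin])
  then have "(\<Sum>t\<in>Z. \<Sum>s\<in>S. r s t * w s) = (\<Sum>t\<in>Z. \<Sum>s\<in>S. r t s * w t)"
    by simp
  then have "(\<Sum>t\<in>Z. \<Sum>s\<in>Z. r s t * w s) + (\<Sum>t\<in>Z. \<Sum>s\<in>S - Z. r s t * w s)
      = (\<Sum>t\<in>Z. \<Sum>s\<in>Z. r t s * w t) + (\<Sum>t\<in>Z. \<Sum>s\<in>S - Z. r t s * w t)"
    by (simp add: split sum.distrib)
  moreover have "(\<Sum>t\<in>Z. \<Sum>s\<in>Z. r s t * w s) = (\<Sum>t\<in>Z. \<Sum>s\<in>Z. r t s * w t)"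
    by (rule sum.swap)
  moreover have "(\<Sum>t\<in>Z. \<Sum>s\<in>S - Z. r t s * w t) = 0"
    using closed by (intro sum.neutral ballI) auto
  ultimately have "(\<Sum>t\<in>Z. \<Sum>s\<in>S - Z. r s t * w s) = 0" by simp
  moreover have nn: "0 \<le> r s t * w s" if "s \<in> S - Z" for s t
    using that nonneg pos[of s] by (simp add: less_imp_le)
  ultimately have "(\<Sum>s\<in>S - Z. r s t * w s) = 0"
    using t finZ by (subst (asm) sum_nonneg_eq_0_iff) (auto intro!: sum_nonneg)
  then have "r s t * w s = 0"
    using s fin nn by (subst (asm) sum_nonneg_eq_0_iff) auto
  then show ?thesis using pos[of s] s by auto
qed

text \<open>
  Subtracting from \<open>v\<close> the largest multiple of \<open>w\<close> that lies below it leaves a nonnegative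
  stationary weight with a zero. No positive value flows into a zero, so the complement of the
  zero set is closed under transitions. The zero set is then closed as well, and two disjoint
  closed sets cannot both contain \<open>s0\<close>.
\<close>

lemma stationary_weight_unique:
  fixes r :: "'s \<Rightarrow> 's \<Rightarrow> real"
  assumes chain: "markov_chain S r" and stat: "stationary_weight S r w"
    and pos: "\<And>s. s \<in> S \<Longrightarrow> 0 < w s"
    and sink: "\<And>Z. \<lbrakk>Z \<subseteq> S; Z \<noteq> {}; \<And>s t. s \<in> Z \<Longrightarrow> t \<in> S - Z \<Longrightarrow> r s t = 0\<rbrakk> \<Longrightarrow> s0 \<in> Z"
    and v: "stationary_weight S r v"
  shows "\<exists>c. \<forall>s\<in>S. v s = c * w s"
proof -
  have fin: "finite S" and ne: "S \<noteq> {}" and nonneg: "\<And>s t. s \<in> S \<Longrightarrow> 0 \<le> r s t"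
    using chain by (auto simp: markov_chain_def)
  define c where "c = Min ((\<lambda>s. v s / w s) ` S)"
  define u where "u s = v s - c * w s" for s
  have "c \<in> (\<lambda>s. v s / w s) ` S"
    unfolding c_def using fin ne by (intro Min_in) auto
  then obtain z where z: "z \<in> S" "c = v z / w z" by auto
  have c_le: "c \<le> v s / w s" if "s \<in> S" for s
    unfolding c_def using fin that by (intro Min_le) auto
  have u_nonneg: "0 \<le> u s" if "s \<in> S" for s
    using c_le[OF that] pos[OF that] by (simp add: u_def pos_le_divide_eq)
  have u_stat: "(\<Sum>s\<in>S. r s t * u s) = (\<Sum>s\<in>S. r t s * u t)" if "t \<in> S" for t
  proof -
    have "(\<Sum>s\<in>S. r s t * u s) = (\<Sum>s\<in>S. r s t * v s) - c * (\<Sum>s\<in>S. r s t * w s)"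
      by (simp add: u_def algebra_simps sum_subtractf sum_distrib_left)
    also have "\<dots> = (\<Sum>s\<in>S. r t s * v t) - c * (\<Sum>s\<in>S. r t s * w t)"
      using stat v that by (simp add: stationary_weight_iff[OF fin])
    also have "\<dots> = (\<Sum>s\<in>S. r t s * u t)"
      by (simp add: u_def algebra_simps sum_subtractf sum_distrib_left)
    finally show ?thesis .
  qed
  define Z where "Z = {s \<in> S. u s = 0}"
  have "z \<in> Z" using z pos[of z] by (auto simp: Z_def u_def)
  have no_flow: "r s t = 0" if "s \<in> S - Z" "t \<in> Z" for s t
  proof -
    have "(\<Sum>s\<in>S. r s t * u s) = 0" using u_stat[of t] that by (simp add: Z_def)
    then have "r s t * u s = 0"
      using that u_nonneg nonneg fin by (subst (asm) sum_nonneg_eq_0_iff) auto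
    then show ?thesis using that by (auto simp: Z_def)
  qed
  have "S - Z = {}"
  proof (rule ccontr)
    assume "S - Z \<noteq> {}"
    moreover have "S - (S - Z) = Z" by (auto simp: Z_def)
    ultimately have 1: "s0 \<in> S - Z" using sink[of "S - Z"] no_flow by auto
    have "r s t = 0" if "s \<in> Z" "t \<in> S - Z" for s t
      by (rule forward_closed_imp_backward_closed[OF chain stat pos, of "S - Z"])
        (use that no_flow \<open>S - (S - Z) = Z\<close> in auto)
    moreover have "Z \<subseteq> S" "Z \<noteq> {}" using \<open>z \<in> Z\<close> by (auto simp: Z_def)
    ultimately have "s0 \<in> Z" using sink[of Z] by blast
    with 1 show False by simp
  qed
  then have "\<forall>s\<in>S. v s = c * w s" by (auto simp: Z_def u_def)
  then show ?thesis ..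
qed

text \<open>
  Suppose that the transitions are labelled, and that the transition \<open>(s, e)\<close> carries the same
  weight as a transition \<open>(t, e')\<close> that leaves the target \<open>t\<close> of \<open>(s, e)\<close>, where \<open>e'\<close> has a mark
  \<open>\<beta> t e'\<close> from which, together with \<open>t\<close>, the transition \<open>(s, e)\<close> can be recovered. Then
  \<open>(s, e) \<mapsto> (t, e')\<close> is an injective map from the finite set of all transitions to
  itself, hence a bijection, and it matches the weight entering each \<open>t\<close> with the weight leaving it.
\<close>

lemma stationary_weight_if_matching:
  fixes r :: "'s \<Rightarrow> 's \<Rightarrow> real" and \<beta> :: "'s \<Rightarrow> 'e \<Rightarrow> 'b"
  assumes fin: "finite S" and finE: "\<And>s. s \<in> S \<Longrightarrow> finite (E s)"
    and target: "\<And>s e. s \<in> S \<Longrightarrow> e \<in> E s \<Longrightarrow> tgt s e \<in> S"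
    and rate: "\<And>s t. s \<in> S \<Longrightarrow> r s t = (\<Sum>e | e \<in> E s \<and> tgt s e = t. \<rho> s e)"
    and match: "\<And>s e. s \<in> S \<Longrightarrow> e \<in> E s \<Longrightarrow>
        \<exists>e'\<in>E (tgt s e). \<beta> (tgt s e) e' = b s e \<and>
          \<rho> s e * w s = \<rho> (tgt s e) e' * w (tgt s e)"
    and inj: "\<And>s e s' e'. \<lbrakk>s \<in> S; e \<in> E s; s' \<in> S; e' \<in> E s'; tgt s e = tgt s' e'; b s e = b s' e'\<rbrakk>
        \<Longrightarrow> s = s' \<and> e = e'"
  shows "stationary_weight S r w"
proof -
  define T where "T = (SIGMA s:S. E s)"
  define tg where "tg = (\<lambda>(s, e). tgt s e)"
  have finT: "finite T" unfolding T_def using fin finE by auto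
  define mt where "mt p = (SOME e'. e' \<in> E (tg p) \<and> \<beta> (tg p) e' = b (fst p) (snd p) \<and>
      \<rho> (fst p) (snd p) * w (fst p) = \<rho> (tg p) e' * w (tg p))" for p
  have mt: "mt p \<in> E (tg p) \<and> \<beta> (tg p) (mt p) = b (fst p) (snd p) \<and>
      \<rho> (fst p) (snd p) * w (fst p) = \<rho> (tg p) (mt p) * w (tg p)" if "p \<in> T" for p
    unfolding mt_def
  proof (rule someI_ex)
    have "fst p \<in> S" "snd p \<in> E (fst p)" "tg p = tgt (fst p) (snd p)"
      using that by (auto simp: T_def tg_def)
    then show "\<exists>e'. e' \<in> E (tg p) \<and> \<beta> (tg p) e' = b (fst p) (snd p) \<and>
        \<rho> (fst p) (snd p) * w (fst p) = \<rho> (tg p) e' * w (tg p)"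
      using match[of "fst p" "snd p"] by auto
  qed
  define \<Phi> where "\<Phi> p = (tg p, mt p)" for p
  have "inj_on \<Phi> T"
  proof (rule inj_onI)
    fix p q assume pq: "p \<in> T" "q \<in> T" "\<Phi> p = \<Phi> q"
    then have "tg p = tg q" "b (fst p) (snd p) = b (fst q) (snd q)"
      using mt[of p] mt[of q] by (auto simp: \<Phi>_def)
    then show "p = q"
      using pq inj[of "fst p" "snd p" "fst q" "snd q"] by (auto simp: T_def tg_def)
  qed
  moreover have "\<Phi> ` T \<subseteq> T" using mt target by (auto simp: \<Phi>_def T_def tg_def)
  ultimately have surj: "\<Phi> ` T = T" by (intro endo_inj_surj finT) auto
  show ?thesis unfolding stationary_weight_iff[OF fin]
  proof
    fix t assume t: "t \<in> S"
    have "(\<Sum>s\<in>S. r s t * w s) = (\<Sum>s\<in>S. \<Sum>e\<in>E s. if tgt s e = t then \<rho> s e * w s else 0)"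
      by (intro sum.cong[OF refl]) (auto simp: rate sum_distrib_right finE sum.inter_filter intro!: sum.cong)
    also have "\<dots> = (\<Sum>p\<in>T. if tg p = t then \<rho> (fst p) (snd p) * w (fst p) else 0)"
      unfolding T_def using fin finE by (subst sum.Sigma) (auto simp: tg_def case_prod_beta)
    also have "\<dots> = (\<Sum>p\<in>T. if fst (\<Phi> p) = t then \<rho> (fst (\<Phi> p)) (snd (\<Phi> p)) * w (fst (\<Phi> p)) else 0)"
      using mt by (intro sum.cong) (auto simp: \<Phi>_def)
    also have "\<dots> = (\<Sum>p\<in>T. if fst p = t then \<rho> (fst p) (snd p) * w (fst p) else 0)"
      using sum.reindex[OF \<open>inj_on \<Phi> T\<close>,
          of "\<lambda>p. if fst p = t then \<rho> (fst p) (snd p) * w (fst p) else 0"]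
      by (simp add: surj o_def)
    also have "\<dots> = (\<Sum>s\<in>S. \<Sum>e\<in>E s. if s = t then \<rho> s e * w s else 0)"
      unfolding T_def using fin finE by (subst sum.Sigma) (auto simp: case_prod_beta)
    also have "\<dots> = (\<Sum>e\<in>E t. \<rho> t e * w t)"
    proof -
      have "(\<Sum>s\<in>S. \<Sum>e\<in>E s. if s = t then \<rho> s e * w s else 0)
          = (\<Sum>s\<in>S. if s = t then \<Sum>e\<in>E s. \<rho> s e * w s else 0)"
        by (intro sum.cong) auto
      then show ?thesis using t fin by simp
    qed
    also have "\<dots> = (\<Sum>s\<in>S. \<Sum>e | e \<in> E t \<and> tgt t e = s. \<rho> t e * w t)"
      using target[OF t] by (intro sum.group[OF finE[OF t] fin, symmetric]) auto
    also have "\<dots> = (\<Sum>s\<in>S. r t s * w t)"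
      using t by (simp add: rate sum_distrib_right)
    finally show "(\<Sum>s\<in>S. r s t * w s) = (\<Sum>s\<in>S. r t s * w t)" .
  qed
qed


section \<open>Cyclic columns\<close>

lemma mod_add_cancel:
  fixes a b c N :: nat
  assumes eq: "(a + c) mod N = (b + c) mod N" and N: "0 < N"
  shows "a mod N = b mod N"
proof -
  have "(d + c + (N - 1) * c) mod N = d mod N" for d
  proof -
    have "d + c + (N - 1) * c = d + c * N" using N by (cases N) (simp_all add: algebra_simps)
    then show ?thesis by (simp only: mod_mult_self1)
  qed
  then show ?thesis using eq by (metis mod_add_left_eq)
qed

lemma offset_inj:
  fixes l :: nat
  assumes "(l + a) mod N = (l + b) mod N" "a < N" "b < N"
  shows "a = b"
proof -
  have "a = b" if "(l + a) mod N = (l + b) mod N" "a \<le> b" "b < N" for a b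
  proof -
    have "N dvd b - a"
      using that mod_eq_dvd_iff_nat[of "l + a" "l + b" N] by auto
    then show ?thesis using that by (auto dest!: dvd_imp_le)
  qed
  from this[of a b] this[of b a] assms show ?thesis by (cases "a \<le> b") auto
qed

lemma offset_eq_iff: "a < N \<Longrightarrow> b < N \<Longrightarrow> (l + a) mod N = (l + b) mod N \<longleftrightarrow> a = (b::nat)"
  using offset_inj by blast

lemma offset_0_iff: "l < N \<Longrightarrow> b < N \<Longrightarrow> (l + b) mod N = l \<longleftrightarrow> b = (0::nat)"
  using offset_eq_iff[of b N 0 l] by auto

lemma offset_exists:
  fixes j l N :: nat
  assumes "j < N" "l < N"
  obtains a where "a < N" "(l + a) mod N = j"
proof
  show "(j + (N - l)) mod N < N" using assms by simp
  have "l + (j + (N - l)) = j + N" using assms by simp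
  then show "(l + (j + (N - l)) mod N) mod N = j"
    using assms by (simp add: mod_add_right_eq)
qed

lemma right_of_offset: "right_of N ((l + a) mod N) = (l + Suc a) mod N"
  by (simp add: right_of_def mod_Suc_eq)

lemma right_of_less: "i < N \<Longrightarrow> right_of N i < N"
  by (simp add: right_of_def)

lemma left_of_less: "i < N \<Longrightarrow> left_of N i < N"
  by (simp add: left_of_def)

lemma left_of_offset: "0 < N \<Longrightarrow> left_of N ((l + Suc a) mod N) = (l + a) mod N"
proof -
  assume "0 < N"
  then have *: "l + Suc a + (N - 1) = l + a + N" by simp
  show ?thesis unfolding left_of_def mod_add_left_eq * by simp
qed

lemma left_of_right_of: "i < N \<Longrightarrow> left_of N (right_of N i) = i"
  using left_of_offset[of N i 0] by (simp add: right_of_def)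

lemma right_of_left_of: "i < N \<Longrightarrow> right_of N (left_of N i) = i"
  using right_of_offset[of N i "N - 1"] by (simp add: left_of_def)

lemma bij_betw_offset:
  assumes "l < N"
  shows "bij_betw (\<lambda>a. (l + a) mod N) {..<N} {..<N::nat}"
  unfolding bij_betw_def
proof
  show "inj_on (\<lambda>a. (l + a) mod N) {..<N}"
    by (auto intro!: inj_onI dest: offset_inj)
  show "(\<lambda>a. (l + a) mod N) ` {..<N} = {..<N}"
    using assms by (auto elim: offset_exists[of _ N l])
qed


section \<open>Flows\<close>

text \<open>
  The flow at column \<open>k\<close> is the number of bully paths that pass through \<open>(2, k)\<close>. A path is
  absorbed at each particle of row 2 that is reached, and a path starts below each particle of
  row 1, which gives the recursion; the truncated subtraction expresses that no path is absorbed
  where none arrives. The flow is extended periodically to all natural numbers, so that a column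
  \<open>k mod N\<close> can be addressed by any \<open>k\<close>.
\<close>

definition flow :: "nat \<Rightarrow> mlq \<Rightarrow> (nat \<Rightarrow> nat) \<Rightarrow> bool" where
  "flow N Q h \<longleftrightarrow> (\<forall>k. h (k + N) = h k) \<and>
     (\<forall>k. h (Suc k) = h k - of_bool (k mod N \<in> snd Q) + of_bool (Suc k mod N \<in> fst Q))"

lemma flow_periodic: "flow N Q h \<Longrightarrow> h (k + N) = h k"
  by (simp add: flow_def)

lemma flow_Suc:
  "flow N Q h \<Longrightarrow> h (Suc k) = h k - of_bool (k mod N \<in> snd Q) + of_bool (Suc k mod N \<in> fst Q)"
  by (simp add: flow_def)

lemma flow_periodic_mult: "flow N Q h \<Longrightarrow> h (k + n * N) = h k"
proof (induction n)
  case (Suc n)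
  then show ?case using flow_periodic[of N Q h "k + n * N"] by (simp add: algebra_simps)
qed simp

lemma flow_mod: "flow N Q h \<Longrightarrow> h (k mod N) = h k"
  using flow_periodic_mult[of N Q h "k mod N" "k div N"] by simp

lemma flow_from_offsets:
  assumes l: "l < N"
    and g: "\<And>a. a < N \<Longrightarrow> g (Suc a mod N) =
        g a - of_bool ((l + a) mod N \<in> snd Q) + of_bool ((l + Suc a) mod N \<in> fst Q)"
  obtains h where "flow N Q h" "\<And>a. a < N \<Longrightarrow> h (l + a) = g a"
proof
  define off where "off k = (k + (N - l)) mod N" for k
  have "(l + off k) mod N = k mod N" for k
  proof -
    have "(l + off k) mod N = (l + (k + (N - l))) mod N" by (simp add: off_def mod_add_right_eq)
    also have "l + (k + (N - l)) = k + N" using l by simp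
    finally show ?thesis by simp
  qed
  note off = this
  have off_Suc: "off (Suc k) = Suc (off k) mod N" for k
    by (simp add: off_def mod_Suc_eq)
  show "flow N Q (\<lambda>k. g (off k))"
    unfolding flow_def
  proof (intro conjI allI)
    fix k
    have "k + N + (N - l) = k + (N - l) + N" by simp
    then show "g (off (k + N)) = g (off k)" unfolding off_def by (metis mod_add_self2)
    have "(l + Suc (off k)) mod N = Suc k mod N"
      using off[of k] by (metis add_Suc_right mod_Suc_eq)
    then show "g (off (Suc k)) =
        g (off k) - of_bool (k mod N \<in> snd Q) + of_bool (Suc k mod N \<in> fst Q)"
      using g[of "off k"] l off[of k] by (simp add: off_Suc) (simp add: off_def)
  qed
  show "g (off (l + a)) = g a" if "a < N" for a
    using that l by (simp add: off_def)
qed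

text \<open>
  If paths arrived everywhere, each particle of row 2 would absorb one, and there would be as many
  paths as particles in row 2.
\<close>

lemma flow_has_zero:
  assumes h: "flow N Q h" and fin: "snd Q \<subseteq> {..<N}" "fst Q \<subseteq> {..<N}"
    and card: "card (fst Q) < card (snd Q)"
  obtains k where "k < N" "h k = 0"
proof -
  have "\<exists>k<N. h k = 0"
  proof (rule ccontr)
    assume "\<not> (\<exists>k<N. h k = 0)"
    then have "h (Suc k) + of_bool (k \<in> snd Q) = h k + of_bool (Suc k mod N \<in> fst Q)" if "k < N" for k
      using that flow_Suc[OF h, of k] by (auto simp: of_bool_def)
    then have "(\<Sum>k<N. h (Suc k) + of_bool (k \<in> snd Q))
        = (\<Sum>k<N. h k + of_bool (Suc k mod N \<in> fst Q) :: nat)"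
      by (intro sum.cong) auto
    then have "(\<Sum>k<N. h (Suc k)) + (\<Sum>k<N. of_bool (k \<in> snd Q))
        = (\<Sum>k<N. h k) + (\<Sum>k<N. of_bool (Suc k mod N \<in> fst Q) :: nat)"
      by (simp only: sum.distrib)
    moreover have "(\<Sum>k<N. h (Suc k)) = (\<Sum>k<N. h k)"
      using sum.lessThan_Suc[of h N] sum.lessThan_Suc_shift[of h N] flow_periodic[OF h, of 0] by simp
    moreover have "(\<Sum>k<N. of_bool (k \<in> snd Q) :: nat) = card (snd Q)"
      using fin by (simp add: sum.If_cases of_bool_def Int_absorb1)
    moreover have "(\<Sum>k<N. of_bool (Suc k mod N \<in> fst Q) :: nat) = card (fst Q)"
    proof (cases "N = 0")
      case False
      have "(\<Sum>k<N. of_bool (Suc k mod N \<in> fst Q) :: nat) = (\<Sum>k<N. of_bool (k \<in> fst Q))"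
        (is "?L = _")
      proof -
        have "?L = (\<Sum>k<N. of_bool ((1 mod N + k) mod N \<in> fst Q))"
          by (intro sum.cong refl) (metis mod_add_left_eq plus_1_eq_Suc)
        also have "\<dots> = (\<Sum>k<N. of_bool (k \<in> fst Q))"
          using sum.reindex_bij_betw[OF bij_betw_offset[of "1 mod N" N],
              of "\<lambda>k. of_bool (k \<in> fst Q) :: nat"] False by simp
        finally show ?thesis .
      qed
      then show ?thesis using fin by (simp add: sum.If_cases of_bool_def Int_absorb1)
    qed (use fin in auto)
    ultimately show False using card by simp
  qed
  then show thesis using that by blast
qed

text \<open>
  The recursion is monotone, so that a flow which vanishes at some column stays below
  any other flow from there on, and hence everywhere.
\<close>

lemma flow_unique:
  assumes "flow N Q h" "flow N Q h'" "fst Q \<subseteq> {..<N}" "snd Q \<subseteq> {..<N}"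
    and "card (fst Q) < card (snd Q)"
  shows "h = h'"
proof -
  have le: "h j \<le> h' j" if h: "flow N Q h" and h': "flow N Q h'" for h h' j
  proof -
    obtain k where k: "k < N" "h k = 0" using flow_has_zero[OF h] assms by metis
    have "h (k + n) \<le> h' (k + n)" for n
    proof (induction n)
      case (Suc n)
      then show ?case using flow_Suc[OF h, of "k + n"] flow_Suc[OF h', of "k + n"] by simp
    qed (simp add: k)
    moreover have "k \<le> j + k * N" using k by (cases N) auto
    ultimately have "h (j + k * N) \<le> h' (j + k * N)"
      by (metis le_add_diff_inverse)
    then show ?thesis using flow_periodic_mult[OF h] flow_periodic_mult[OF h'] by simp
  qed
  show ?thesis using le[of h h'] le[of h' h] assms by (intro ext antisym) auto
qed

text \<open>
  A new path adds one unit of flow from its start up to the first particle of row 2 that has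
  not been reached before. The particles it passes on the way absorb older paths.
\<close>

lemma bully_paths_flow_list:
  assumes "distinct xs" "set xs \<subseteq> {..<N}" "length xs \<le> card R2" "R2 \<subseteq> {..<N}"
  shows "\<exists>h. flow N (set xs, R2) h \<and>
    fold (bully_step N R2) xs ({}, {}) = ({j \<in> R2. 0 < h j}, {j. j < N \<and> 0 < h j}) \<and>
    card {j \<in> R2. 0 < h j} = length xs"
  using assms
proof (induction xs rule: rev_induct)
  case Nil
  show ?case by (rule exI[of _ "\<lambda>_. 0"]) (auto simp: flow_def)
next
  case (snoc i xs)
  then obtain h where h: "flow N (set xs, R2) h"
    and fold: "fold (bully_step N R2) xs ({}, {}) = ({j \<in> R2. 0 < h j}, {j. j < N \<and> 0 < h j})"
    and card: "card {j \<in> R2. 0 < h j} = length xs"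
    by auto
  define C where "C = {j \<in> R2. 0 < h j}"
  have i: "i < N" "i \<notin> set xs" and finR: "finite R2"
    using snoc.prems finite_subset by auto
  have "card C < card R2" using card snoc.prems by (simp add: C_def)
  then have "R2 - C \<noteq> {}"
    using card_mono[of C R2] finR by (auto simp: C_def)
  then obtain j where j: "j \<in> R2 - C" by auto
  then obtain d0 where d0: "d0 < N" "(i + d0) mod N = j"
    using offset_exists[of j N i] i snoc.prems by auto
  define d where "d = (LEAST d. (i + d) mod N \<in> R2 - C)"
  have d: "(i + d) mod N \<in> R2 - C"
    unfolding d_def by (rule LeastI[of _ d0]) (use d0 j in auto)
  have d_min: "(i + a) mod N \<notin> R2 - C" if "a < d" for a
    using that not_less_Least unfolding d_def by blast
  have "d \<le> d0" unfolding d_def by (rule Least_le) (use d0 j in auto)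
  then have dN: "d < N" using d0 by simp
  have in_C: "(i + a) mod N \<in> C \<longleftrightarrow> (i + a) mod N \<in> R2 \<and> 0 < h (i + a)" for a
    using flow_mod[OF h, of "i + a"] by (simp add: C_def)
  define g where "g a = h (i + a) + of_bool (a \<le> d)" for a
  have start: "h (i + N) = h i" by (rule flow_periodic[OF h])
  have "g (Suc a mod N) = g a - of_bool ((i + a) mod N \<in> snd (set (xs @ [i]), R2))
      + of_bool ((i + Suc a) mod N \<in> fst (set (xs @ [i]), R2))" if a: "a < N" for a
  proof -
    have step: "h (i + Suc a) = h (i + a) - of_bool ((i + a) mod N \<in> R2)
        + of_bool ((i + Suc a) mod N \<in> set xs)"
      using flow_Suc[OF h, of "i + a"] by simp
    have absorb: "(i + a) mod N \<in> R2 \<Longrightarrow> 0 < h (i + a)" if "a < d"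
      using d_min[OF that] in_C[of a] by auto
    have last: "(i + a) mod N \<in> R2 \<and> h (i + a) = 0" if "a = d"
      using d in_C[of a] that by auto
    show ?thesis
    proof (cases "Suc a < N")
      case True
      then have "(i + Suc a) mod N \<noteq> i" using offset_0_iff[of i N "Suc a"] i by simp
      then show ?thesis
        using True step absorb last by (cases a d rule: linorder_cases) (auto simp: g_def of_bool_def)
    next
      case False
      then have "Suc a = N" using a by simp
      then have "(i + Suc a) mod N = i" using i by simp
      then show ?thesis
        using \<open>Suc a = N\<close> step absorb last dN start i
        by (cases a d rule: linorder_cases) (auto simp: g_def of_bool_def)
    qed
  qed
  then obtain h' where h': "flow N (set (xs @ [i]), R2) h'"
    and h'_eq: "\<And>a. a < N \<Longrightarrow> h' (i + a) = g a"
    using flow_from_offsets[of i N g "(set (xs @ [i]), R2)"] i by metis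
  have pos: "0 < h' j \<longleftrightarrow> 0 < h j \<or> j \<in> (\<lambda>e. (i + e) mod N) ` {..d}" if j: "j < N" for j
  proof -
    obtain a where a: "a < N" "(i + a) mod N = j" using offset_exists[OF j i(1)] by blast
    have "j \<in> (\<lambda>e. (i + e) mod N) ` {..d} \<longleftrightarrow> a \<le> d"
      using a dN by (auto simp: offset_eq_iff)
    moreover have "h' j = g a" "h j = h (i + a)"
      using a flow_mod[OF h', of "i + a"] flow_mod[OF h, of "i + a"] h'_eq[of a] by auto
    ultimately show ?thesis by (auto simp: g_def)
  qed
  have "{j \<in> R2. 0 < h' j} = insert ((i + d) mod N) C"
  proof -
    have "{j \<in> R2. 0 < h' j} = C \<union> (R2 \<inter> (\<lambda>e. (i + e) mod N) ` {..d})"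
      using pos snoc.prems by (auto simp: C_def)
    also have "\<dots> = insert ((i + d) mod N) C"
      using d d_min by (auto simp: C_def le_less)
    finally show ?thesis .
  qed
  moreover have "{j. j < N \<and> 0 < h' j} = {j. j < N \<and> 0 < h j} \<union> (\<lambda>e. (i + e) mod N) ` {..d}"
    using pos i by auto
  moreover have "finite C" using finR by (simp add: C_def)
  moreover have "(i + d) mod N \<notin> C" using d by simp
  moreover have "bully_step N R2 i (C, {j. j < N \<and> 0 < h j})
      = (insert ((i + d) mod N) C, {j. j < N \<and> 0 < h j} \<union> (\<lambda>e. (i + e) mod N) ` {..d})"
    by (simp add: bully_step_def d_def Let_def)
  ultimately show ?case
    using h' fold card by (intro exI[of _ h']) (simp add: C_def[symmetric])
qed

lemma bully_paths_flow:
  assumes "fst Q \<subseteq> {..<N}" "snd Q \<subseteq> {..<N}" "card (fst Q) \<le> card (snd Q)"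
  shows "\<exists>h. flow N Q h \<and> first_class N Q = {j \<in> snd Q. 0 < h j} \<and>
    traversed N Q = {j. j < N \<and> 0 < h j} \<and> card (first_class N Q) = card (fst Q)"
proof -
  have "finite (fst Q)" using assms finite_subset by blast
  then show ?thesis
    using bully_paths_flow_list[of "sorted_list_of_set (fst Q)" N "snd Q"] assms
    by (auto simp: first_class_def traversed_def bully_paths_def)
qed


section \<open>Words of multiline queues\<close>

locale queue_type =
  fixes m1 m2 m3 N :: nat
  assumes m_pos: "0 < m1" "0 < m2" "0 < m3" and N_def: "N = m1 + m2 + m3"
begin

abbreviation "queues \<equiv> multiline_queues m1 m2 m3"

lemma queuesD:
  assumes "Q \<in> queues"
  shows "fst Q \<subseteq> {..<N}" "snd Q \<subseteq> {..<N}" "card (fst Q) = m1" "card (snd Q) = m1 + m2"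
    "finite (fst Q)" "finite (snd Q)"
  using assms by (auto simp: multiline_queues_def N_def
      dest: finite_subset[OF _ finite_lessThan])

lemma finite_queues: "finite queues"
proof (rule finite_subset)
  show "queues \<subseteq> Pow {..<N} \<times> Pow {..<N}"
    by (auto simp: multiline_queues_def N_def)
qed simp

end

locale queue_with_flow = queue_type +
  fixes Q :: mlq and h :: "nat \<Rightarrow> nat"
  assumes queue: "Q \<in> queues" and h: "flow N Q h"
begin

abbreviation "p \<equiv> bully_projection N Q"

lemma columns: "fst Q \<subseteq> {..<N}" "snd Q \<subseteq> {..<N}"
  using queuesD[OF queue] by auto

lemma N_pos: "0 < N" using m_pos by (simp add: N_def)

lemma bully_paths_eq:
  "first_class N Q = {j \<in> snd Q. 0 < h j}" "traversed N Q = {j. j < N \<and> 0 < h j}"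
  "card {j \<in> snd Q. 0 < h j} = m1"
proof -
  obtain h' where h': "flow N Q h'" "first_class N Q = {j \<in> snd Q. 0 < h' j}"
      "traversed N Q = {j. j < N \<and> 0 < h' j}" "card (first_class N Q) = card (fst Q)"
    using bully_paths_flow[of Q N] queuesD[OF queue] by auto
  moreover have "h' = h"
    using flow_unique[OF h'(1) h] queuesD[OF queue] m_pos by simp
  ultimately show "first_class N Q = {j \<in> snd Q. 0 < h j}" "traversed N Q = {j. j < N \<and> 0 < h j}"
    "card {j \<in> snd Q. 0 < h j} = m1"
    using queuesD[OF queue] by auto
qed

lemma length_word [simp]: "length p = N"
  by (simp add: bully_projection_def)

lemma letter_eq:
  "p ! (k mod N) = (if k mod N \<notin> snd Q then 3 else if h k = 0 then 2 else 1)"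
  using N_pos flow_mod[OF h, of k] by (simp add: bully_projection_def bully_paths_eq)

lemma letter_eq_3: "p ! (k mod N) = 3 \<longleftrightarrow> k mod N \<notin> snd Q"
  and letter_eq_2: "p ! (k mod N) = 2 \<longleftrightarrow> k mod N \<in> snd Q \<and> h k = 0"
  and letter_eq_1: "p ! (k mod N) = 1 \<longleftrightarrow> k mod N \<in> snd Q \<and> 0 < h k"
  and letter_cases: "p ! (k mod N) = 1 \<or> p ! (k mod N) = 2 \<or> p ! (k mod N) = 3"
  by (simp_all add: letter_eq)

lemma covered_threes_eq: "covered_threes N Q = {i. i < N \<and> i \<notin> snd Q \<and> 0 < h i}"
proof -
  have "p ! i = 3 \<longleftrightarrow> i \<notin> snd Q" if "i < N" for i
    using letter_eq_3[of i] that by simp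
  then show ?thesis by (auto simp: covered_threes_def bully_paths_eq)
qed

lemma card_covered_threes_le: "card (covered_threes N Q) \<le> m3"
proof -
  have "card (covered_threes N Q) \<le> card ({..<N} - snd Q)"
    by (rule card_mono) (auto simp: covered_threes_eq)
  also have "\<dots> = m3" using queuesD[OF queue] by (simp add: card_Diff_subset N_def)
  finally show ?thesis .
qed

lemma card_covered_threes_offset:
  assumes "l < N"
  shows "card (covered_threes N Q) = (\<Sum>a<N. of_bool ((l + a) mod N \<notin> snd Q \<and> 0 < h (l + a)))"
proof -
  have "card (covered_threes N Q) = (\<Sum>j<N. of_bool (j \<notin> snd Q \<and> 0 < h j))"
    by (simp add: covered_threes_eq sum.If_cases of_bool_def Int_def)
  also have "\<dots> = (\<Sum>a<N. of_bool ((l + a) mod N \<notin> snd Q \<and> 0 < h ((l + a) mod N)))"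
    by (rule sum.reindex_bij_betw[OF bij_betw_offset[OF assms], symmetric])
  finally show ?thesis by (simp add: flow_mod[OF h])
qed

lemma word_in_words: "p \<in> words m1 m2 m3"
proof -
  have count: "count_list p c = card {i. i < N \<and> p ! i = c}" for c
  proof -
    have "{i. i < N \<and> c = p ! i} = {i. i < N \<and> p ! i = c}" by auto
    then show ?thesis by (simp add: count_list_eq_length_filter length_filter_conv_card)
  qed
  have nth: "p ! i = (if i \<notin> snd Q then 3 else if h i = 0 then 2 else 1)" if "i < N" for i
    using letter_eq[of i] that by simp
  have c1: "count_list p 1 = m1"
  proof -
    have "{i. i < N \<and> p ! i = 1} = {j \<in> snd Q. 0 < h j}"
      using columns by (auto simp: nth split: if_splits)
    then show ?thesis using bully_paths_eq(3) by (simp add: count)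
  qed
  have c2: "count_list p 2 = m2"
  proof -
    have "{i. i < N \<and> p ! i = 2} = snd Q - {j \<in> snd Q. 0 < h j}"
      using columns by (auto simp: nth split: if_splits)
    then have "card {i. i < N \<and> p ! i = 2} = card (snd Q) - card {j \<in> snd Q. 0 < h j}"
      using queuesD[OF queue] by (simp add: card_Diff_subset)
    then show ?thesis using bully_paths_eq(3) queuesD[OF queue] by (simp add: count)
  qed
  have c3: "count_list p 3 = m3"
  proof -
    have "{i. i < N \<and> p ! i = 3} = {..<N} - snd Q"
      by (auto simp: nth split: if_splits)
    then show ?thesis unfolding count
      using queuesD[OF queue] by (simp add: card_Diff_subset) (simp add: N_def)
  qed
  have "set p \<subseteq> {1, 2, 3}" by (auto simp: bully_projection_def)
  then show ?thesis using c1 c2 c3 by (simp add: words_def flip: N_def)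
qed

end

context queue_type
begin

lemma queue_with_flow_exists:
  assumes "Q \<in> queues"
  obtains h where "queue_with_flow m1 m2 m3 N Q h"
proof -
  obtain h where "flow N Q h"
    using bully_paths_flow[of Q N] queuesD[OF assms] by auto
  then show thesis
    using that assms by (simp add: queue_with_flow_def queue_with_flow_axioms_def queue_type_axioms)
qed

end


section \<open>Jumps at a descent\<close>

context queue_type
begin

text \<open>The rearranged rows are queues because a jump moves particles only onto vacant positions.\<close>

lemma in_queues_if_inj_images:
  assumes Q: "Q \<in> queues" and f: "inj_on f (fst Q)" "inj_on g (snd Q)"
    and "f ` fst Q \<subseteq> {..<N}" "g ` snd Q \<subseteq> {..<N}"
  shows "(f ` fst Q, g ` snd Q) \<in> queues"
  using queuesD[OF Q] assms by (auto simp: multiline_queues_def N_def card_image)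

end

lemma hop_left_eq_image:
  assumes "i \<in> R"
  shows "hop_left N i R = (if left_of N i \<in> R then id else id(i := left_of N i)) ` R"
  using assms by (auto simp: hop_left_def)

lemma shift_left_eq_image:
  "shift_left N D R = (\<lambda>j. if j \<in> D then left_of N j else j) ` R"
  by (auto simp: shift_left_def)

text \<open>
  A descent is described by its left column \<open>l\<close>; the front seat that jumps is the column to the
  right of \<open>l\<close>.
\<close>

locale descent = queue_with_flow +
  fixes l :: nat
  assumes l: "l < N" and descent: "p ! right_of N l < p ! l"
begin

abbreviation "col a \<equiv> (l + a) mod N"

definition i :: nat where "i = right_of N l"

lemma N_ge: "3 \<le> N" using m_pos by (simp add: N_def)

lemma front_simps [simp]: "right_of N l = i" "Suc l mod N = i" "left_of N i = l" "l mod N = l" "i < N"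
  using left_of_right_of[OF l] right_of_less[OF l] l by (simp_all add: i_def right_of_def)

lemma col_eq_iff: "a < N \<Longrightarrow> b < N \<Longrightarrow> col a = col b \<longleftrightarrow> a = b"
  by (rule offset_eq_iff)

lemma col_eq_l_iff: "a < N \<Longrightarrow> col a = l \<longleftrightarrow> a = 0"
  using col_eq_iff[of a 0] N_pos by simp

lemma col_eq_i_iff: "a < N \<Longrightarrow> col a = i \<longleftrightarrow> a = 1"
  using col_eq_iff[of a 1] N_ge by simp

lemma i_neq_l [simp]: "i \<noteq> l" "l \<noteq> i"
  using col_eq_l_iff[of 1] N_ge by auto

lemma flow_step: "h (l + Suc a) = h (l + a) - of_bool (col a \<in> snd Q) + of_bool (col (Suc a) \<in> fst Q)"
  using flow_Suc[OF h, of "l + a"] by simp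

lemma flow_wrap: "h (l + N) = h l"
  by (rule flow_periodic[OF h])

lemma flow_front: "h (Suc l) = h l - of_bool (l \<in> snd Q) + of_bool (i \<in> fst Q)"
  using flow_step[of 0] by simp

lemma particle_imp_flow: "l \<in> fst Q \<Longrightarrow> 0 < h l"
  using flow_step[of "N - 1"] flow_wrap N_pos by simp

lemma l_letter: "p ! l = 3 \<longleftrightarrow> l \<notin> snd Q" "p ! l = 2 \<longleftrightarrow> l \<in> snd Q \<and> h l = 0"
  using letter_eq_3[of l] letter_eq_2[of l] by auto

lemma i_letter: "p ! i = 1 \<longleftrightarrow> i \<in> snd Q \<and> 0 < h (Suc l)" "p ! i = 2 \<longleftrightarrow> i \<in> snd Q \<and> h (Suc l) = 0"
  using letter_eq_1[of "Suc l"] letter_eq_2[of "Suc l"] by auto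

lemma descent_cases:
  "p ! l = 3 \<or> (p ! l = 2 \<and> p ! i = 1)" "p ! i = 1 \<or> p ! i = 2"
  using descent letter_cases[of l] letter_cases[of "Suc l"] by auto

lemma front_particle [simp]: "i \<in> snd Q"
  using descent_cases(2) i_letter by auto

lemma nth_swap_right:
  assumes "a < N"
  shows "swap_right l p ! col a = (if a = 0 then p ! i else if a = 1 then p ! l else p ! col a)"
  using assms l col_eq_l_iff[of a] col_eq_i_iff[of a]
  by (auto simp: swap_right_def Let_def nth_list_update)

lemma length_swap_right: "length (swap_right l p) = N"
  by (simp add: swap_right_def Let_def)

lemma word_eqI:
  assumes "length u = N" "length v = N" "\<And>a. a < N \<Longrightarrow> u ! col a = v ! col a"
  shows "u = v"
proof (rule nth_equalityI)
  fix i assume "i < length u"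
  then obtain a where "a < N" "col a = i" using offset_exists[of i N l] assms(1) l by metis
  then show "u ! i = v ! i" using assms(3) by auto
qed (use assms in simp)

text \<open>
  By uniqueness of flows, it is enough to guess the flow \<open>g\<close> after the jump, counted from column
  \<open>l\<close>, and to check the recursion.
\<close>

lemma jump_result:
  assumes t: "t \<in> queues"
    and g: "\<And>a. a < N \<Longrightarrow> g (Suc a mod N) =
        (g a :: nat) - of_bool (col a \<in> snd t) + of_bool (col (Suc a) \<in> fst t)"
    and word: "\<And>a. a < N \<Longrightarrow> swap_right l p ! col a =
        (if col a \<notin> snd t then 3 else if g a = 0 then 2 else 1)"
  shows "bully_projection N t = swap_right l p"
    and "card (covered_threes N t) = (\<Sum>a<N. of_bool (col a \<notin> snd t \<and> 0 < g a))"
proof -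
  obtain h' where h': "flow N t h'" "\<And>a. a < N \<Longrightarrow> h' (l + a) = g a"
    using flow_from_offsets[of l N g t] l g by metis
  interpret t: queue_with_flow m1 m2 m3 N t h'
    by unfold_locales (use t h' in auto)
  show "bully_projection N t = swap_right l p"
    using word h' t.letter_eq[of "l + a" for a] length_swap_right by (intro word_eqI) auto
  show "card (covered_threes N t) = (\<Sum>a<N. of_bool (col a \<notin> snd t \<and> 0 < g a))"
    unfolding t.card_covered_threes_offset[OF l] using h' by (intro sum.cong) auto
qed

end


section \<open>Regular jumps\<close>

locale regular = descent +
  assumes front_1: "p ! right_of N l = 1" and occupied: "right_of N l \<in> fst Q"
begin

abbreviation "t \<equiv> regular_jump N i Q"

lemma occ [simp]: "i \<in> fst Q"
  using occupied by simp

lemma fst_t: "fst t = (if l \<in> fst Q then fst Q else insert l (fst Q - {i}))"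
  and snd_t: "snd t = (if l \<in> snd Q then snd Q else insert l (snd Q - {i}))"
  by (simp_all add: regular_jump_def hop_left_def)

lemma t_in_queues: "t \<in> queues"
proof -
  have "inj_on (id(i := l)) R" if "l \<notin> R" for R
    using that by (auto simp: inj_on_def)
  then show ?thesis
    using columns l unfolding regular_jump_def hop_left_eq_image[OF occ]
      hop_left_eq_image[OF front_particle] front_simps
    by (intro in_queues_if_inj_images[OF queue]) auto
qed

lemma l_particle: "l \<in> snd Q \<Longrightarrow> h l = 0" "l \<in> snd Q \<Longrightarrow> l \<notin> fst Q"
  using descent_cases l_letter particle_imp_flow by auto

text \<open>
  The path that starts at the front seat now starts one column earlier, unless row 1 is already
  occupied there.
\<close>

definition g :: "nat \<Rightarrow> nat" where
  "g a = (if a = 0 then h l + 1 - of_bool (l \<in> fst Q) else if a = 1 then h (Suc l) - 1 else h (l + a))"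

lemma g_flow:
  assumes a: "a < N"
  shows "g (Suc a mod N) = g a - of_bool (col a \<in> snd t) + of_bool (col (Suc a) \<in> fst t)"
proof -
  consider "a = 0" | "a = 1" | "2 \<le> a" "Suc a < N" | "Suc a = N" "2 \<le> a" using a N_ge by linarith
  then show ?thesis
  proof cases
    case 1
    then show ?thesis
      using N_ge flow_front l_particle particle_imp_flow by (auto simp: g_def fst_t snd_t)
  next
    case 2
    then have "col 2 \<noteq> l" "col 2 \<noteq> i"
      using N_ge col_eq_l_iff[of 2] col_eq_i_iff[of 2] by auto
    then show ?thesis
      using 2 N_ge flow_front l_particle flow_step[of 1] by (auto simp: g_def fst_t snd_t)
  next
    case 3
    then have "col a \<noteq> l" "col a \<noteq> i" "col (Suc a) \<noteq> l" "col (Suc a) \<noteq> i"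
      using col_eq_l_iff[of a] col_eq_l_iff[of "Suc a"] col_eq_i_iff[of a] col_eq_i_iff[of "Suc a"]
      by auto
    then show ?thesis using 3 flow_step[of a] by (simp add: g_def fst_t snd_t)
  next
    case 4
    then have "col a \<noteq> l" "col a \<noteq> i" "col (Suc a) = l"
      using col_eq_l_iff[of a] col_eq_i_iff[of a] by auto
    then show ?thesis
      using 4 flow_step[of a] flow_wrap particle_imp_flow by (simp add: g_def fst_t snd_t)
  qed
qed

lemma swapped_letter:
  assumes a: "a < N"
  shows "swap_right l p ! col a = (if col a \<notin> snd t then 3 else if g a = 0 then 2 else 1)"
proof -
  consider "a = 0" | "a = 1" | "2 \<le> a" by linarith
  then show ?thesis
  proof cases
    case 1
    then show ?thesis
      using nth_swap_right[OF a] front_1 particle_imp_flow by (simp add: g_def snd_t)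
  next
    case 2
    then show ?thesis
      using nth_swap_right[OF a] descent_cases l_letter flow_front
      by (auto simp: g_def snd_t)
  next
    case 3
    then have "col a \<noteq> l" "col a \<noteq> i"
      using col_eq_l_iff[of a] col_eq_i_iff[of a] a by auto
    then show ?thesis
      using 3 nth_swap_right[OF a] letter_eq[of "l + a"] by (simp add: g_def snd_t)
  qed
qed

lemma word_t: "bully_projection N t = swap_right l p"
  using t_in_queues g_flow swapped_letter by (rule jump_result(1))

lemma card_covered_t_sum: "card (covered_threes N t) = (\<Sum>a<N. of_bool (col a \<notin> snd t \<and> 0 < g a))"
  using t_in_queues g_flow swapped_letter by (rule jump_result(2))

text \<open>The 3 that changes places with the front seat keeps its status.\<close>

lemma card_covered_t: "card (covered_threes N t) = card (covered_threes N Q)"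
proof -
  have "N = Suc (Suc (N - 2))" using N_ge by simp
  then obtain n where n: "N = Suc (Suc n)" ..
  have split: "(\<Sum>a<N. f a) = f 0 + (f 1 + (\<Sum>a<n. f (Suc (Suc a))))" for f :: "nat \<Rightarrow> nat"
    by (simp add: n sum.lessThan_Suc_shift del: sum.lessThan_Suc)
  have "(\<Sum>a<n. of_bool (col (Suc (Suc a)) \<notin> snd t \<and> 0 < g (Suc (Suc a))) :: nat)
      = (\<Sum>a<n. of_bool (col (Suc (Suc a)) \<notin> snd Q \<and> 0 < h (l + Suc (Suc a))))"
  proof (rule sum.cong)
    fix a assume "a \<in> {..<n}"
    then have "col (Suc (Suc a)) \<noteq> l" "col (Suc (Suc a)) \<noteq> i"
      using col_eq_l_iff[of "Suc (Suc a)"] col_eq_i_iff[of "Suc (Suc a)"] n by auto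
    then show "(of_bool (col (Suc (Suc a)) \<notin> snd t \<and> 0 < g (Suc (Suc a))) :: nat)
        = of_bool (col (Suc (Suc a)) \<notin> snd Q \<and> 0 < h (l + Suc (Suc a)))"
      by (simp add: g_def snd_t)
  qed simp
  note rest = this
  show ?thesis
    unfolding card_covered_t_sum card_covered_threes_offset[OF l] split rest
    using flow_front by (simp add: g_def snd_t)
qed

end


section \<open>Pulling jumps\<close>

text \<open>
  The offset \<open>e\<close> is that of the first cut to the right of the front seat. The particles of
  row 1 in the columns \<open>col 2, \<dots>, col e\<close> are pulled: these are the remaining
  seats of the coupe, or the next coupe if the front seat is also the back seat.
\<close>

locale pulling = descent +
  fixes e :: nat
  assumes not_regular: "\<not> (p ! right_of N l = 1 \<and> right_of N l \<in> fst Q)"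
    and e: "2 \<le> e" "e < N"
    and cut_e: "cut_right p ((l + e) mod N)"
    and no_cut: "\<And>a. 2 \<le> a \<Longrightarrow> a < e \<Longrightarrow> \<not> cut_right p ((l + a) mod N)"
begin

abbreviation "t \<equiv> (shift_left N (col ` {2..e}) (fst Q), insert l (snd Q - {i}))"

lemma l_vacant [simp]: "l \<notin> snd Q"
  using not_regular descent_cases l_letter i_letter flow_front by (auto split: if_splits)

lemma i_vacant [simp]: "i \<notin> fst Q"
  using not_regular descent_cases i_letter flow_front by auto

lemma h_front: "h (Suc l) = h l"
  using flow_front by simp

lemma same_letter_next:
  assumes "2 \<le> a" "a < e" "col a \<in> snd Q"
  shows "col (Suc a) \<in> snd Q \<and> (h (l + Suc a) = 0 \<longleftrightarrow> h (l + a) = 0)"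
proof -
  have "\<not> cut_right p (col a)" using no_cut assms by simp
  then have "p ! col (Suc a) = p ! col a"
    using letter_cases[of "l + a"] letter_eq_3[of "l + a"] assms(3)
    by (auto simp: cut_right_def right_of_offset)
  then have "(p ! col (Suc a) = c) = (p ! col a = c)" for c by simp
  from this[of 3] this[of 2] show ?thesis
    unfolding letter_eq_3 letter_eq_2 using assms(3) by blast
qed

lemma e_particle: "col e \<in> snd Q"
  using cut_e letter_eq_3[of "l + e"] by (auto simp: cut_right_def)

text \<open>
  No particle of row 1 in \<open>col 3, \<dots>, col e\<close> is directly to the right of a 2, since within a
  coupe a 2 is followed by a 2, which is not reached by any path. So these paths may start one
  column earlier without being absorbed there.
\<close>

lemma earlier_start:
  assumes "2 \<le> a" "a < e"
  shows "h (l + Suc a) = h (l + a) + of_bool (col (Suc a) \<in> fst Q) - of_bool (col a \<in> snd Q)"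
  using flow_step[of a] same_letter_next[OF assms] by (cases "h (l + a)") auto

definition g :: "nat \<Rightarrow> nat" where
  "g a = (if a = 1 then h (l + 2)
     else if 2 \<le> a \<and> a < e then h (l + a) + of_bool (col (Suc a) \<in> fst Q) else h (l + a))"

lemma left: "2 \<le> b \<Longrightarrow> left_of N (col b) = col (b - 1)"
  using left_of_offset[OF N_pos, of l] by (cases b) auto

lemma pulled_iff: "b < N \<Longrightarrow> col b \<in> col ` {2..e} \<longleftrightarrow> 2 \<le> b \<and> b \<le> e"
  using e col_eq_iff by (auto simp: image_iff)

definition pull :: "nat \<Rightarrow> nat" where
  "pull b = (if 2 \<le> b \<and> b \<le> e then b - 1 else b)"

lemma pull_less: "b < N \<Longrightarrow> pull b < N"
  by (auto simp: pull_def)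

lemma pull_col:
  "b < N \<Longrightarrow> (if col b \<in> col ` {2..e} then left_of N (col b) else col b) = col (pull b)"
  using pulled_iff[of b] left[of b] by (simp add: pull_def)

lemma pull_eq_iff:
  assumes "b \<noteq> 1"
  shows "pull b = a \<longleftrightarrow> (if 1 \<le> a \<and> a < e then b = Suc a else b = a \<and> a \<noteq> e)"
  using assms e by (auto simp: pull_def)

lemma offset_of_particle:
  assumes "j \<in> fst Q"
  obtains b where "b < N" "b \<noteq> 1" "col b = j"
proof -
  obtain b where b: "b < N" "col b = j" using assms columns l offset_exists[of j N l] by blast
  have "b \<noteq> 1" using b(2) assms by auto
  from b(1) this b(2) show thesis by (rule that)
qed

lemma fst_t:
  assumes a: "a < N"
  shows "col a \<in> fst t \<longleftrightarrow> (if 1 \<le> a \<and> a < e then col (Suc a) \<in> fst Q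
    else a \<noteq> e \<and> col a \<in> fst Q)"
proof -
  have "col a \<in> fst t \<longleftrightarrow> (\<exists>b<N. b \<noteq> 1 \<and> col b \<in> fst Q \<and> pull b = a)"
  proof
    assume "col a \<in> fst t"
    then obtain j where j: "j \<in> fst Q" "col a = (if j \<in> col ` {2..e} then left_of N j else j)"
      unfolding fst_conv shift_left_eq_image by (rule imageE)
    obtain b where b: "b < N" "b \<noteq> 1" "col b = j" using j(1) by (rule offset_of_particle)
    have "col a = col (pull b)" using j(2) unfolding b(3)[symmetric] pull_col[OF b(1)] .
    then have "pull b = a" using col_eq_iff[OF a pull_less[OF b(1)]] by simp
    with b j(1) show "\<exists>b<N. b \<noteq> 1 \<and> col b \<in> fst Q \<and> pull b = a" by blast
  next
    assume "\<exists>b<N. b \<noteq> 1 \<and> col b \<in> fst Q \<and> pull b = a"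
    then obtain b where b: "b < N" "col b \<in> fst Q" "pull b = a" by blast
    show "col a \<in> fst t"
      unfolding fst_conv shift_left_eq_image
      by (rule image_eqI[OF _ b(2)]) (simp only: pull_col[OF b(1)] b(3))
  qed
  also have "\<dots> \<longleftrightarrow> (if 1 \<le> a \<and> a < e then col (Suc a) \<in> fst Q else a \<noteq> e \<and> col a \<in> fst Q)"
  proof -
    have "col 1 \<notin> fst Q" by simp
    moreover have "Suc a < N" if "a < e" using that e by simp
    ultimately show ?thesis
      using a pull_eq_iff[of _ a] by (metis Suc_eq_plus1 add_cancel_left_left le_numeral_extra(3))
  qed
  finally show ?thesis .
qed

lemma snd_t:
  assumes "a < N"
  shows "col a \<in> snd t \<longleftrightarrow> (if a = 0 then True else if a = 1 then False else col a \<in> snd Q)"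
  using assms col_eq_l_iff[of a] col_eq_i_iff[of a] by auto

lemma t_in_queues: "t \<in> queues"
proof -
  define f where "f j = (if j \<in> col ` {2..e} then left_of N j else j)" for j
  define f' where "f' j = (if j = i then l else j)" for j
  have "inj_on f (fst Q)"
  proof (rule inj_onI)
    fix j k assume jk: "j \<in> fst Q" "k \<in> fst Q" "f j = f k"
    obtain a where a: "a < N" "a \<noteq> 1" "col a = j" using jk(1) by (rule offset_of_particle)
    obtain b where b: "b < N" "b \<noteq> 1" "col b = k" using jk(2) by (rule offset_of_particle)
    have "col (pull a) = col (pull b)"
      using jk(3) unfolding f_def a(3)[symmetric] b(3)[symmetric] pull_col[OF a(1)] pull_col[OF b(1)] .
    then have "pull a = pull b" using col_eq_iff a b pull_less by blast
    then have "a = b" using pull_eq_iff[OF a(2), of "pull b"] pull_eq_iff[OF b(2), of "pull b"]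
      by (auto split: if_splits)
    then show "j = k" using a b by simp
  qed
  moreover have "inj_on f' (snd Q)"
    by (auto simp: inj_on_def f'_def)
  moreover have "f ` fst Q \<subseteq> {..<N}" "f' ` snd Q \<subseteq> {..<N}"
    using columns left_of_less l N_pos by (auto simp: f_def f'_def)
  moreover have "t = (f ` fst Q, f' ` snd Q)"
    by (auto simp: shift_left_eq_image f_def f'_def)
  ultimately show ?thesis using in_queues_if_inj_images[OF queue] by simp
qed

lemma g_flow:
  assumes a: "a < N"
  shows "g (Suc a mod N) = g a - of_bool (col a \<in> snd t) + of_bool (col (Suc a) \<in> fst t)"
proof -
  consider "a = 0" | "a = 1" | "2 \<le> a" "a < e" | "e \<le> a" "Suc a < N" | "Suc a = N" using a by linarith
  then show ?thesis
  proof cases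
    case 1
    then show ?thesis
      using N_ge e fst_t[of 1] snd_t[of 0] h_front flow_step[of 1] by (simp add: g_def)
  next
    case 2
    then show ?thesis
      using N_ge e fst_t[of "Suc (Suc 0)"] snd_t[of 1] by (auto simp: g_def)
  next
    case 3
    then show ?thesis
      using e fst_t[of "Suc a"] snd_t[of a] earlier_start[of a] by (auto simp: g_def)
  next
    case 4
    then show ?thesis
      using e fst_t[of "Suc a"] snd_t[of a] flow_step[of a] by (auto simp: g_def)
  next
    case 5
    then show ?thesis
      using N_ge e fst_t[of 0] snd_t[of a] flow_step[of a] flow_wrap by (auto simp: g_def)
  qed
qed

lemma swapped_letter:
  assumes a: "a < N"
  shows "swap_right l p ! col a = (if col a \<notin> snd t then 3 else if g a = 0 then 2 else 1)"
proof -
  consider "a = 0" | "a = 1" | "2 \<le> a" "a < e" | "e \<le> a" by linarith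
  then show ?thesis
  proof cases
    case 1
    then show ?thesis
      using nth_swap_right[OF a] snd_t[of 0] descent_cases i_letter h_front N_pos by (auto simp: g_def)
  next
    case 2
    then show ?thesis using nth_swap_right[OF a] snd_t[of 1] N_ge l_letter by simp
  next
    case 3
    then show ?thesis
      using nth_swap_right[OF a] snd_t[OF a] letter_eq[of "l + a"] same_letter_next[of a]
        flow_step[of a] by (auto simp: g_def)
  next
    case 4
    then show ?thesis
      using nth_swap_right[OF a] snd_t[OF a] letter_eq[of "l + a"] e by (auto simp: g_def)
  qed
qed

lemma word_t: "bully_projection N t = swap_right l p"
  using t_in_queues g_flow swapped_letter by (rule jump_result(1))

lemma card_covered_t_sum: "card (covered_threes N t) = (\<Sum>a<N. of_bool (col a \<notin> snd t \<and> 0 < g a))"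
  using t_in_queues g_flow swapped_letter by (rule jump_result(2))

text \<open>
  A 3 in one of the columns \<open>col 1, \<dots>, col (e - 1)\<close> of the new queue is covered iff the flow in
  the next column was positive before the jump. So only the two ends contribute: a covered 3 is
  lost at \<open>l\<close> if the front seat is a 1, and one is gained if the pulled columns end with a 1. In the
  proof, \<open>u a - u 0\<close> is the excess of the new count over the old one in the columns before \<open>col a\<close>.
\<close>

lemma card_covered_t:
  "card (covered_threes N t) + of_bool (p ! i = 1) = card (covered_threes N Q) + of_bool (p ! col e = 1)"
proof -
  define f where "f a = (of_bool (col a \<notin> snd Q \<and> 0 < h (l + a)) :: nat)" for a
  define f' where "f' a = (of_bool (col a \<notin> snd t \<and> 0 < g a) :: nat)" for a
  define u where "u a = (if a = 0 then of_bool (p ! i = 1) else if a = 1 then 0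
    else if a \<le> e then of_bool (0 < h (l + a)) else of_bool (0 < h (l + e)) :: nat)" for a
  have step: "f' a + u a = f a + u (Suc a)" if a: "a < N" for a
  proof -
    consider "a = 0" | "a = 1" | "2 \<le> a" "a < e" | "a = e" | "e < a" by linarith
    then show ?thesis
    proof cases
      case 1
      then show ?thesis using i_letter h_front by (simp add: f_def f'_def u_def)
    next
      case 2
      then show ?thesis using snd_t[of 1] N_ge e by (simp add: f_def f'_def u_def g_def numeral_2_eq_2)
    next
      case 3
      then show ?thesis
        using snd_t[OF a] same_letter_next[of a] flow_step[of a]
        by (auto simp: f_def f'_def u_def g_def)
    next
      case 4
      then show ?thesis using snd_t[OF a] e e_particle by (simp add: f_def f'_def u_def)
    next
      case 5
      then show ?thesis using snd_t[OF a] e by (simp add: f_def f'_def u_def g_def)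
    qed
  qed
  have "(\<Sum>a<n. f' a) + u 0 = (\<Sum>a<n. f a) + u n" if "n \<le> N" for n
    using that
  proof (induction n)
    case (Suc n)
    then show ?case using step[of n] by simp
  qed simp
  from this[of N] have "(\<Sum>a<N. f' a) + u 0 = (\<Sum>a<N. f a) + u N" by simp
  moreover have "u N = of_bool (p ! col e = 1)"
    using e e_particle letter_eq_1[of "l + e"] by (simp add: u_def)
  ultimately show ?thesis
    unfolding card_covered_t_sum card_covered_threes_offset[OF l] by (simp add: f_def f'_def u_def)
qed

end


section \<open>Coupes and descents\<close>

locale word =
  fixes N :: nat and p :: "nat list"
  assumes length_p: "length p = N" and letters: "set p \<subseteq> {1, 2, 3}"
    and has_1: "1 \<in> set p" and has_2: "2 \<in> set p"
begin

lemma N_pos: "0 < N" using length_p has_1 by auto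

lemma letter_range: "p ! (k mod N) = 1 \<or> p ! (k mod N) = 2 \<or> p ! (k mod N) = 3"
proof -
  have "p ! (k mod N) \<in> set p" using N_pos length_p by (intro nth_mem) simp
  then show ?thesis using letters by auto
qed

lemma cut_right_iff:
  "cut_right p ((s + a) mod N) \<longleftrightarrow>
    p ! ((s + a) mod N) \<noteq> 3 \<and> p ! ((s + Suc a) mod N) \<noteq> p ! ((s + a) mod N)"
  using letter_range[of "s + a"] by (auto simp: cut_right_def length_p right_of_offset)

lemma cut_exists:
  assumes c: "c = 1 \<or> c = 2"
  obtains j where "j < N" "p ! j = c" "cut_right p j"
proof -
  \<comment> \<open>The letter \<open>3 - c\<close> is the other one of the letters 1 and 2.\<close>
  have in_p: "c \<in> set p" "3 - c \<in> set p" "c \<noteq> 3 - c" "c \<noteq> 3" using c has_1 has_2 by auto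
  obtain s where s: "s < N" "p ! s = c" using in_p length_p by (metis in_set_conv_nth)
  obtain k where k: "k < N" "p ! k = 3 - c" using in_p length_p by (metis in_set_conv_nth)
  obtain b where b: "b < N" "(s + b) mod N = k" using offset_exists[OF k(1) s(1)] by blast
  define a where "a = (LEAST a. p ! ((s + a) mod N) \<noteq> c)"
  have a: "p ! ((s + a) mod N) \<noteq> c"
    unfolding a_def by (rule LeastI[of _ b]) (use b k in_p in simp)
  then have "a \<noteq> 0" using s by (metis add_0_right mod_less)
  then obtain a' where a': "a = Suc a'" using not0_implies_Suc by blast
  have "p ! ((s + a') mod N) = c"
    using not_less_Least[of a' "\<lambda>a. p ! ((s + a) mod N) \<noteq> c"] a' by (simp add: a_def)
  then show thesis
    using that[of "(s + a') mod N"] a a' in_p N_pos cut_right_iff[of s a'] by simp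
qed

definition cut_dist :: "nat \<Rightarrow> nat" where
  "cut_dist s = (LEAST d. cut_right p ((s + d) mod N))"

lemma cut_dist_cut:
  assumes "s < N"
  shows "cut_right p ((s + cut_dist s) mod N)"
proof -
  obtain j where j: "j < N" "cut_right p j" using cut_exists[of 1] by blast
  obtain b where "(s + b) mod N = j" using offset_exists[OF j(1) assms] by blast
  then have "cut_right p ((s + b) mod N)" using j by simp
  then show ?thesis unfolding cut_dist_def by (rule LeastI[of _ b])
qed

lemma cut_dist_le: "cut_right p ((s + d) mod N) \<Longrightarrow> cut_dist s \<le> d"
  unfolding cut_dist_def by (rule Least_le)

lemma cut_distI:
  assumes "cut_right p ((s + d) mod N)" "\<And>a. a < d \<Longrightarrow> \<not> cut_right p ((s + a) mod N)"
  shows "cut_dist s = d"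
  unfolding cut_dist_def by (rule Least_equality) (use assms in \<open>auto simp: not_less[symmetric]\<close>)

lemma coupe_from_eq: "coupe_from p s = map (\<lambda>a. (s + a) mod N) [0..<Suc (cut_dist s)]"
  by (simp add: coupe_from_def cut_dist_def length_p Let_def)

definition front_dist :: "nat \<Rightarrow> nat" where
  "front_dist s = (LEAST a. p ! ((s + a) mod N) \<noteq> 3)"

lemma front_dist_letter: "s < N \<Longrightarrow> p ! ((s + front_dist s) mod N) \<noteq> 3"
  unfolding front_dist_def
  by (rule LeastI[of _ "cut_dist s"]) (use cut_dist_cut cut_right_iff in blast)

lemma front_dist_3: "a < front_dist s \<Longrightarrow> p ! ((s + a) mod N) = 3"
  unfolding front_dist_def using not_less_Least by blast

lemma front_dist_le: "s < N \<Longrightarrow> front_dist s \<le> cut_dist s"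
  unfolding front_dist_def by (rule Least_le) (use cut_dist_cut cut_right_iff in blast)

lemma seat_letter:
  assumes s: "s < N" and a: "front_dist s \<le> a" "a \<le> cut_dist s"
  shows "p ! ((s + a) mod N) = p ! ((s + front_dist s) mod N)"
  using a
proof (induction a rule: dec_induct)
  case (step a)
  then have "\<not> cut_right p ((s + a) mod N)" using cut_dist_le[of s a] by auto
  moreover have "p ! ((s + a) mod N) \<noteq> 3" using step front_dist_letter[OF s] by simp
  ultimately show ?case using step cut_right_iff[of s a] by auto
qed simp

lemma seats_eq:
  assumes s: "s < N"
  shows "seats p (coupe_from p s) = map (\<lambda>a. (s + a) mod N) [front_dist s..<Suc (cut_dist s)]"
proof -
  have "[0..<Suc (cut_dist s)] = [0..<front_dist s] @ [front_dist s..<Suc (cut_dist s)]"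
    using front_dist_le[OF s] upt_add_eq_append[of 0 "front_dist s" "Suc (cut_dist s) - front_dist s"]
    by simp
  moreover have "[front_dist s..<Suc (cut_dist s)] = front_dist s # [Suc (front_dist s)..<Suc (cut_dist s)]"
    using front_dist_le[OF s] by (simp add: upt_conv_Cons)
  ultimately show ?thesis
    unfolding seats_def coupe_from_eq
    using front_dist_letter[OF s] front_dist_3[of _ s] by (simp add: dropWhile_append del: upt_Suc)
qed

lemma front_seat_eq: "s < N \<Longrightarrow> front_seat p (coupe_from p s) = (s + front_dist s) mod N"
  using front_dist_le[of s] by (simp add: front_seat_def seats_eq upt_conv_Cons del: upt_Suc)

lemma back_seat_eq: "back_seat (coupe_from p s) = (s + cut_dist s) mod N"
  by (simp add: back_seat_def coupe_from_eq)

lemma can_jump_iff: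
  assumes s: "s < N"
  shows "can_jump p (coupe_from p s) \<longleftrightarrow> 0 < front_dist s \<or> p ! ((s + front_dist s) mod N) = 1"
proof -
  have "can_jump p (coupe_from p s) \<longleftrightarrow> (\<exists>a\<le>cut_dist s. p ! ((s + a) mod N) \<noteq> 2)"
    by (auto simp: can_jump_def coupe_from_eq less_Suc_eq_le simp del: upt_Suc)
  also have "\<dots> \<longleftrightarrow> 0 < front_dist s \<or> p ! ((s + front_dist s) mod N) = 1"
  proof (cases "front_dist s = 0")
    case True
    then have "p ! ((s + a) mod N) = p ! ((s + front_dist s) mod N)" if "a \<le> cut_dist s" for a
      using seat_letter[OF s, of a] that by simp
    then show ?thesis
      using True front_dist_letter[OF s] letter_range[of "s + front_dist s"] by auto
  next
    case False
    then show ?thesis using front_dist_3[of 0 s] by (auto intro!: exI[of _ 0])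
  qed
  finally show ?thesis .
qed

abbreviation "descents \<equiv> {l. l < N \<and> p ! right_of N l < p ! l}"

abbreviation "starts \<equiv> {s. s < N \<and> cut_right p (left_of N s)}"

lemma coupes_eq: "coupes p = coupe_from p ` starts"
  by (simp add: coupes_def length_p)

text \<open>
  In a coupe with 3's the front seat follows a 3. A coupe without 3's follows a back seat of the
  other class, which is smaller only if the coupe consists of 2's; such a coupe cannot jump.
\<close>

lemma front_descent:
  assumes s: "s \<in> starts" and jump: "can_jump p (coupe_from p s)"
  shows "left_of N (front_seat p (coupe_from p s)) \<in> descents"
proof -
  have sN: "s < N" using s by simp
  define F where "F = (s + front_dist s) mod N"
  have F: "F < N" "p ! F \<noteq> 3" using front_dist_letter[OF sN] N_pos by (auto simp: F_def)
  then have F12: "p ! F = 1 \<or> p ! F = 2" using letter_range[of F] by simp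
  have "p ! F < p ! left_of N F"
  proof (cases "front_dist s")
    case 0
    then have "F = s" using sN by (simp add: F_def)
    then have "p ! F = 1" using jump can_jump_iff[OF sN] 0 by (simp add: F_def)
    moreover have "cut_right p (left_of N s)" using s by simp
    moreover have "right_of N (left_of N s) = s" using right_of_left_of[OF sN] .
    ultimately show ?thesis using \<open>F = s\<close> by (auto simp: cut_right_def length_p)
  next
    case (Suc a)
    then have "left_of N F = (s + a) mod N" using left_of_offset[OF N_pos, of s a] by (simp add: F_def)
    then show ?thesis using front_dist_3[of a s] Suc F12 by auto
  qed
  then show ?thesis
    using F left_of_less right_of_left_of by (simp add: front_seat_eq[OF sN] F_def)
qed

text \<open>Going left from the front seat over 3's, the first other letter ends the previous coupe.\<close>

lemma front_inj:
  assumes s: "s \<in> starts" and s': "s' \<in> starts"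
    and eq: "(s + front_dist s) mod N = (s' + front_dist s') mod N"
  shows "s = s'"
proof -
  have "\<not> front_dist s < front_dist s'" if st: "s \<in> starts" "s' \<in> starts"
    and eq: "(s + front_dist s) mod N = (s' + front_dist s') mod N" for s s'
  proof
    assume lt: "front_dist s < front_dist s'"
    define k where "k = front_dist s' - front_dist s - 1"
    have k: "k < front_dist s'" "front_dist s' = Suc k + front_dist s" using lt by (auto simp: k_def)
    have "(s + front_dist s) mod N = (s' + Suc k + front_dist s) mod N"
      using eq k by (simp add: add.assoc)
    then have "s mod N = (s' + Suc k) mod N"
      using mod_add_cancel N_pos by blast
    then have "left_of N s = (s' + k) mod N"
      using left_of_offset[OF N_pos, of s' k] st by simp
    then have "p ! left_of N s = 3" using front_dist_3[OF k(1)] by simp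
    then show False using st by (auto simp: cut_right_def)
  qed
  from this[of s s'] this[of s' s] have "front_dist s = front_dist s'" using s s' eq by auto
  then show ?thesis using mod_add_cancel[of s "front_dist s" N s'] eq s s' N_pos by simp
qed

text \<open>The coupe of a descent starts with the 3's directly to the left of the front seat.\<close>

lemma descent_is_front:
  assumes l: "l \<in> descents"
  obtains s where "s \<in> starts" "can_jump p (coupe_from p s)" "(s + front_dist s) mod N = right_of N l"
proof -
  define i where "i = right_of N l"
  have lN: "l < N" and desc: "p ! i < p ! l" using l by (auto simp: i_def)
  have i: "i < N" "i = Suc l mod N" using right_of_less[OF lN] by (auto simp: i_def right_of_def)
  \<comment> \<open>The number of 3's directly to the left of \<open>i\<close>; \<open>N - f\<close> steps to the right are \<open>f\<close> steps to the left.\<close>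
  define f where "f = (LEAST f. p ! ((l + (N - f)) mod N) \<noteq> 3)"
  have i3: "p ! i \<noteq> 3" using desc letter_range[of l] lN by auto
  have fN: "f \<le> N - 1" unfolding f_def by (rule Least_le) (use i3 i N_pos in simp)
  have f: "p ! ((l + (N - f)) mod N) \<noteq> 3"
    unfolding f_def by (rule LeastI[of _ "N - 1"]) (use i3 i N_pos in simp)
  have f_min: "p ! ((l + (N - a)) mod N) = 3" if "a < f" for a
    using that not_less_Least unfolding f_def by blast
  define s where "s = (l + Suc (N - f)) mod N"
  have sN: "s < N" using N_pos by (simp add: s_def)
  have s_off: "(s + a) mod N = (l + Suc (N - f) + a) mod N" for a
    by (simp add: s_def mod_add_left_eq)
  have s_f: "(s + f) mod N = i"
  proof -
    have "l + Suc (N - f) + f = Suc l + N" using fN N_pos by simp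
    then show ?thesis unfolding s_off i(2) by (metis mod_add_self2)
  qed
  have "front_dist s = f"
    unfolding front_dist_def
  proof (rule Least_equality)
    show "p ! ((s + f) mod N) \<noteq> 3" using s_f i3 by simp
    fix a assume a: "p ! ((s + a) mod N) \<noteq> 3"
    show "f \<le> a"
    proof (rule ccontr)
      assume "\<not> f \<le> a"
      then have shift: "l + Suc (N - f) + a = l + (N - (f - Suc a))" and "f - Suc a < f"
        using fN N_pos by auto
      then have "p ! ((l + (N - (f - Suc a))) mod N) = 3" using f_min by blast
      then show False using a unfolding s_off shift by contradiction
    qed
  qed
  have left_s: "left_of N s = (l + (N - f)) mod N"
    unfolding s_def by (rule left_of_offset[OF N_pos])
  have "cut_right p (left_of N s)"
  proof -
    have "p ! s \<noteq> p ! left_of N s"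
    proof (cases "f = 0")
      case True
      then have "s = i" using s_f sN by simp
      moreover have "left_of N i = l" unfolding i_def by (rule left_of_right_of[OF lN])
      ultimately have "left_of N s = l" "s = i" by simp_all
      then show ?thesis using desc by simp
    next
      case False
      then have "p ! s = 3" using front_dist_3[of 0 s] \<open>front_dist s = f\<close> sN by simp
      then show ?thesis using f left_s by simp
    qed
    then show ?thesis
      unfolding left_s cut_right_iff using f by (simp add: s_def left_s)
  qed
  then have "s \<in> starts" using sN by simp
  moreover have "can_jump p (coupe_from p s)"
  proof (cases "f = 0")
    case True
    then have "left_of N s = l" using lN left_s by simp
    then have "p ! l \<noteq> 3" using f left_s by simp
    then have "p ! i = 1"
      using desc letter_range[of l] letter_range[of i] lN i by auto
    then show ?thesis using can_jump_iff[OF sN] \<open>front_dist s = f\<close> s_f by simp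
  next
    case False
    then show ?thesis using can_jump_iff[OF sN] \<open>front_dist s = f\<close> by simp
  qed
  ultimately show thesis using that s_f \<open>front_dist s = f\<close> by (simp add: i_def)
qed

lemma bij_betw_front:
  "bij_betw (\<lambda>c. left_of N (front_seat p c)) {c \<in> coupes p. can_jump p c} descents"
  unfolding bij_betw_def
proof
  show "inj_on (\<lambda>c. left_of N (front_seat p c)) {c \<in> coupes p. can_jump p c}"
  proof (rule inj_onI)
    fix c c' assume c: "c \<in> {c \<in> coupes p. can_jump p c}" "c' \<in> {c \<in> coupes p. can_jump p c}"
      and eq: "left_of N (front_seat p c) = left_of N (front_seat p c')"
    from c obtain s s' where s: "s \<in> starts" "c = coupe_from p s" "s' \<in> starts" "c' = coupe_from p s'"
      by (auto simp: coupes_eq)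
    have F: "front_seat p c = (s + front_dist s) mod N" "front_seat p c' = (s' + front_dist s') mod N"
      using s by (simp_all add: front_seat_eq)
    have "right_of N (left_of N (front_seat p c)) = right_of N (left_of N (front_seat p c'))"
      using eq by simp
    then have "front_seat p c = front_seat p c'"
      using F N_pos by (simp add: right_of_left_of)
    then show "c = c'" using front_inj[OF s(1,3)] F s by simp
  qed
  show "(\<lambda>c. left_of N (front_seat p c)) ` {c \<in> coupes p. can_jump p c} = descents"
  proof
    show "(\<lambda>c. left_of N (front_seat p c)) ` {c \<in> coupes p. can_jump p c} \<subseteq> descents"
      using front_descent by (auto simp: coupes_eq)
    show "descents \<subseteq> (\<lambda>c. left_of N (front_seat p c)) ` {c \<in> coupes p. can_jump p c}"
    proof
      fix l assume l: "l \<in> descents"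
      obtain s where s: "s \<in> starts" "can_jump p (coupe_from p s)"
        "(s + front_dist s) mod N = right_of N l" using descent_is_front[OF l] .
      then have "left_of N (front_seat p (coupe_from p s)) = l"
        using l by (simp add: front_seat_eq left_of_right_of)
      then show "l \<in> (\<lambda>c. left_of N (front_seat p c)) ` {c \<in> coupes p. can_jump p c}"
        using s by (auto simp: coupes_eq intro!: image_eqI[of _ _ "coupe_from p s"])
    qed
  qed
qed

text \<open>
  If the front seat is not the back seat, the seats behind it extend up to the first cut after
  it; if it is the back seat, the next coupe extends up to the first cut after it.
\<close>

lemma pulled_columns:
  assumes s: "s < N"
  defines "c \<equiv> coupe_from p s"
  shows "(if front_seat p c = back_seat c then set (next_coupe p c) else set (tl (seats p c)))
    = set (coupe_from p (right_of N (front_seat p c)))"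
proof (cases "front_seat p c = back_seat c")
  case True
  then show ?thesis by (simp add: next_coupe_def length_p)
next
  case False
  then have "front_dist s \<noteq> cut_dist s"
    using front_seat_eq[OF s] back_seat_eq[of s] by (auto simp: c_def)
  then have lt: "front_dist s < cut_dist s" using front_dist_le[OF s] by simp
  define s' where "s' = right_of N (front_seat p c)"
  have s': "s' = (s + Suc (front_dist s)) mod N"
    by (simp add: s'_def c_def front_seat_eq[OF s] right_of_offset)
  have s'_off: "(s' + a) mod N = (s + (Suc (front_dist s) + a)) mod N" for a
    unfolding s' mod_add_left_eq by (simp add: add.assoc)
  define d where "d = cut_dist s - Suc (front_dist s)"
  have d: "Suc (front_dist s) + d = cut_dist s" using lt by (simp add: d_def)
  have "cut_dist s' = d"
  proof (rule cut_distI)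
    show "cut_right p ((s' + d) mod N)"
      unfolding s'_off d by (rule cut_dist_cut[OF s])
    fix a assume "a < d"
    then have "Suc (front_dist s) + a < cut_dist s" using d by simp
    then show "\<not> cut_right p ((s' + a) mod N)"
      unfolding s'_off using cut_dist_le[of s "Suc (front_dist s) + a"] by auto
  qed
  then have "set (coupe_from p s') = (\<lambda>a. (s + (Suc (front_dist s) + a)) mod N) ` {0..<Suc d}"
    unfolding coupe_from_eq using s'_off by (simp del: upt_Suc)
  also have "\<dots> = (\<lambda>a. (s + a) mod N) ` ((\<lambda>a. Suc (front_dist s) + a) ` {0..<Suc d})"
    by (simp add: image_image)
  also have "(\<lambda>a. Suc (front_dist s) + a) ` {0..<Suc d} = {Suc (front_dist s)..<Suc (cut_dist s)}"
  proof -
    have "Suc (front_dist s) + Suc d = Suc (cut_dist s)" using d by simp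
    then show ?thesis by (simp only: image_add_atLeastLessThan add_0 add.commute[of "Suc d"])
  qed
  also have "(\<lambda>a. (s + a) mod N) ` \<dots> = set (tl (seats p c))"
    using front_dist_le[OF s] by (simp add: c_def seats_eq[OF s] map_tl[symmetric] upt_conv_Cons del: upt_Suc)
  finally show ?thesis using False by (simp add: s'_def)
qed

text \<open>Going left from the back seat, the first cut is the back seat of the previous coupe.\<close>

lemma back_inj:
  assumes s: "s \<in> starts" and s': "s' \<in> starts"
    and eq: "back_seat (coupe_from p s) = back_seat (coupe_from p s')"
  shows "s = s'"
proof -
  have "\<not> cut_dist s < cut_dist s'" if st: "s \<in> starts" "s' \<in> starts"
    and eq: "(s + cut_dist s) mod N = (s' + cut_dist s') mod N" for s s'
  proof
    assume lt: "cut_dist s < cut_dist s'"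
    define k where "k = cut_dist s' - cut_dist s - 1"
    have k: "k < cut_dist s'" "cut_dist s' = Suc k + cut_dist s" using lt by (auto simp: k_def)
    have "(s + cut_dist s) mod N = (s' + Suc k + cut_dist s) mod N"
      using eq k by (simp add: add.assoc)
    then have "s mod N = (s' + Suc k) mod N"
      using mod_add_cancel N_pos by blast
    then have "left_of N s = (s' + k) mod N"
      using left_of_offset[OF N_pos, of s' k] st by simp
    then have "cut_right p ((s' + k) mod N)" using st by simp
    then show False using cut_dist_le k(1) by (simp add: leD)
  qed
  from this[of s s'] this[of s' s] have "cut_dist s = cut_dist s'"
    using s s' eq by (auto simp: back_seat_eq)
  then show ?thesis
    using mod_add_cancel[of s "cut_dist s" N s'] eq s s' N_pos by (simp add: back_seat_eq)
qed

lemma front_of_start: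
  assumes s: "s \<in> starts" and p_s: "p ! s = 3"
  obtains l where "l \<in> descents" "back_seat (coupe_from p (right_of N l)) = back_seat (coupe_from p s)"
    "p ! right_of N l = p ! back_seat (coupe_from p s)"
proof
  have sN: "s < N" using s by simp
  have "front_dist s \<noteq> 0" using front_dist_letter[OF sN] p_s sN by (metis add_0_right mod_less)
  then have jump: "can_jump p (coupe_from p s)" using can_jump_iff[OF sN] by simp
  define l where "l = left_of N (front_seat p (coupe_from p s))"
  define F where "F = (s + front_dist s) mod N"
  show "l \<in> descents" unfolding l_def by (rule front_descent[OF s jump])
  have F: "right_of N l = F" using N_pos by (simp add: l_def front_seat_eq[OF sN] right_of_left_of F_def)
  have F_off: "(F + a) mod N = (s + (front_dist s + a)) mod N" for a
    unfolding F_def mod_add_left_eq by (simp add: add.assoc)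
  define d where "d = cut_dist s - front_dist s"
  have d: "front_dist s + d = cut_dist s" using front_dist_le[OF sN] by (simp add: d_def)
  have "cut_dist F = d"
  proof (rule cut_distI)
    show "cut_right p ((F + d) mod N)" unfolding F_off d by (rule cut_dist_cut[OF sN])
    fix a assume "a < d"
    then have "front_dist s + a < cut_dist s" using d by simp
    then show "\<not> cut_right p ((F + a) mod N)"
      unfolding F_off using cut_dist_le[of s "front_dist s + a"] by auto
  qed
  then show "back_seat (coupe_from p (right_of N l)) = back_seat (coupe_from p s)"
    unfolding F back_seat_eq by (simp only: F_off d)
  show "p ! right_of N l = p ! back_seat (coupe_from p s)"
    unfolding F F_def back_seat_eq using seat_letter[OF sN, of "cut_dist s"] front_dist_le[OF sN] by simp
qed

text \<open>Here the front seat is the left end of the run of 1's that ends in column \<open>b\<close>.\<close>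

lemma front_of_back_1:
  assumes b: "b < N" "p ! b = 1" "cut_right p b"
  obtains l where "l \<in> descents" "back_seat (coupe_from p (right_of N l)) = b" "p ! right_of N l = 1"
proof -
  obtain k where k: "k < N" "p ! k = 2" using has_2 length_p by (metis in_set_conv_nth)
  obtain c where c: "c < N" "(b + c) mod N = k" using offset_exists[OF k(1) b(1)] by blast
  \<comment> \<open>The length of the run of 1's that ends in \<open>b\<close>, so that \<open>l\<close> below is the column before the run.\<close>
  define f where "f = (LEAST f. p ! ((b + (N - f)) mod N) \<noteq> 1)"
  have "p ! ((b + (N - (N - c))) mod N) \<noteq> 1" using c k by simp
  then have f: "p ! ((b + (N - f)) mod N) \<noteq> 1" and f_le: "f \<le> N - c"
    unfolding f_def by (rule LeastI, rule Least_le)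
  have f_min: "p ! ((b + (N - a)) mod N) = 1" if "a < f" for a
    using that not_less_Least unfolding f_def by blast
  have "f \<noteq> 0" using f b by (metis diff_zero mod_add_self2 mod_less)
  define l where "l = (b + (N - f)) mod N"
  define F where "F = right_of N l"
  have F_off: "(F + a) mod N = (b + (N - (f - Suc a))) mod N" if "a < f" for a
  proof -
    have "(F + a) mod N = (b + Suc (N - f) + a) mod N"
      by (simp only: F_def l_def right_of_offset mod_add_left_eq)
    also have "b + Suc (N - f) + a = b + (N - (f - Suc a))" using that f_le by simp
    finally show ?thesis .
  qed
  have "F < N" using N_pos by (simp add: F_def right_of_def)
  have F1: "p ! F = 1"
    using F_off[of 0] f_min[of "f - 1"] \<open>f \<noteq> 0\<close> \<open>F < N\<close> by simp
  have F_back: "(F + (f - 1)) mod N = b"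
    using F_off[of "f - 1"] \<open>f \<noteq> 0\<close> b(1) by simp
  have "cut_dist F = f - 1"
  proof (rule cut_distI)
    show "cut_right p ((F + (f - 1)) mod N)" unfolding F_back by (rule b(3))
    fix a assume a: "a < f - 1"
    then have "p ! ((F + a) mod N) = 1" "p ! ((F + Suc a) mod N) = 1"
      using F_off[of a] F_off[of "Suc a"] f_min[of "f - Suc a"] f_min[of "f - Suc (Suc a)"] by auto
    then show "\<not> cut_right p ((F + a) mod N)" by (simp add: cut_right_iff)
  qed
  then have "back_seat (coupe_from p F) = b" using F_back by (simp add: back_seat_eq)
  moreover have "l \<in> descents"
  proof -
    have "p ! l = 2 \<or> p ! l = 3" using f letter_range[of "b + (N - f)"] by (simp add: l_def)
    then have "p ! F < p ! l" using F1 by auto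
    then show ?thesis using N_pos by (simp add: F_def l_def)
  qed
  ultimately show thesis using that F1 by (simp add: F_def)
qed

end

text \<open>
  Indexing the jumps by the descents \<open>l\<close> of the word removes the case distinction between the
  rest of the coupe and the next coupe.
\<close>

definition descent_jump :: "nat \<Rightarrow> mlq \<Rightarrow> nat \<Rightarrow> mlq" where
  "descent_jump N Q l =
     (let p = bully_projection N Q; i = right_of N l
      in if p ! i = 1 \<and> i \<in> fst Q then regular_jump N i Q
         else (shift_left N (set (coupe_from p (right_of N i))) (fst Q), insert l (snd Q - {i})))"

lemma coupe_jump_eq_descent_jump:
  assumes "word N (bully_projection N Q)" and "c \<in> coupes (bully_projection N Q)"
  shows "coupe_jump N c Q = descent_jump N Q (left_of N (front_seat (bully_projection N Q) c))"
proof -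
  interpret word N "bully_projection N Q" by fact
  obtain s where s: "s < N" "c = coupe_from (bully_projection N Q) s" using assms by (auto simp: coupes_eq)
  then have "front_seat (bully_projection N Q) c < N" using N_pos by (simp add: front_seat_eq)
  then show ?thesis
    using pulled_columns[OF s(1)] s(2)
    by (simp add: coupe_jump_def descent_jump_def pulling_jump_def Let_def right_of_left_of)
qed

lemma coupe_rate_eq:
  assumes "word N (bully_projection N Q)"
  defines "p \<equiv> bully_projection N Q"
  shows "coupe_rate N x Q Q' =
    (\<Sum>l | l \<in> {l. l < N \<and> p ! right_of N l < p ! l} \<and> descent_jump N Q l = Q'. x (p ! right_of N l))"
proof -
  interpret word N p using assms by simp
  let ?F = "\<lambda>c. left_of N (front_seat p c)"
  have C: "{c. c \<in> coupes p \<and> can_jump p c \<and> coupe_jump N c Q = Q'}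
      = {c \<in> {c \<in> coupes p. can_jump p c}. descent_jump N Q (?F c) = Q'}"
    using coupe_jump_eq_descent_jump[OF assms(1)] by (auto simp: p_def)
  have bij: "bij_betw ?F {c \<in> {c \<in> coupes p. can_jump p c}. descent_jump N Q (?F c) = Q'}
      {l \<in> descents. descent_jump N Q l = Q'}"
    using bij_betw_front by (rule bij_betw_Collect) simp
  have "front_seat p c = right_of N (?F c)" if "c \<in> coupes p" for c
  proof -
    from that obtain s where "s < N" "c = coupe_from p s" by (auto simp: coupes_eq)
    then show ?thesis using N_pos by (simp add: front_seat_eq right_of_left_of)
  qed
  then have "coupe_rate N x Q Q' =
      (\<Sum>c \<in> {c \<in> {c \<in> coupes p. can_jump p c}. descent_jump N Q (?F c) = Q'}. x (p ! right_of N (?F c)))"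
    unfolding coupe_rate_def Let_def p_def[symmetric] C by (intro sum.cong) auto
  also have "\<dots> = (\<Sum>l \<in> {l \<in> descents. descent_jump N Q l = Q'}. x (p ! right_of N l))"
    by (rule sum.reindex_bij_betw[OF bij])
  finally show ?thesis by simp
qed

lemma exclusion_rate_eq:
  assumes "length p = N"
  shows "exclusion_rate x p p' =
    (\<Sum>l | l \<in> {l. l < N \<and> p ! right_of N l < p ! l} \<and> swap_right l p = p'. x (p ! right_of N l))"
  unfolding exclusion_rate_def by (rule sum.cong) (auto simp: assms)


section \<open>Jumps and coupes of the new word\<close>

context queue_with_flow
begin

lemma is_word: "word N p"
proof
  show "set p \<subseteq> {1, 2, 3}" by (auto simp: bully_projection_def)
  have "count_list p 1 \<noteq> 0" "count_list p 2 \<noteq> 0" using word_in_words m_pos by (auto simp: words_def)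
  then show "1 \<in> set p" "2 \<in> set p" using count_notin by metis+
qed simp

end

definition is_regular :: "nat \<Rightarrow> mlq \<Rightarrow> nat \<Rightarrow> bool" where
  "is_regular N Q l \<longleftrightarrow> bully_projection N Q ! right_of N l = 1 \<and> right_of N l \<in> fst Q"

text \<open>
  The coupe of the queue after the jump that the jump is matched with, given by its back seat:
  the coupe of the front seat's new column if the jump is regular, and that of its old column,
  now a 3, if the jump is pulling.
\<close>

definition mark :: "nat \<Rightarrow> mlq \<Rightarrow> nat \<Rightarrow> nat" where
  "mark N Q l = (if is_regular N Q l then l
     else back_seat (coupe_from (bully_projection N Q) (right_of N (right_of N l))))"

context descent
begin

text \<open>
  There is a cut whose letter differs from the front seat. It bounds the pulled columns, which
  hence do not reach around the circle; and if they end directly to the left of \<open>l\<close>, their last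
  letter is not the one that arrives at \<open>l\<close>, so that the cut at their end survives the jump.
\<close>

lemma pulling_case:
  assumes not_reg: "\<not> is_regular N Q l"
  obtains e where "pulling m1 m2 m3 N Q h l e" "e = N - 1 \<Longrightarrow> p ! col e \<noteq> p ! i" "mark N Q l = col e"
    "descent_jump N Q l = (shift_left N (col ` {2..e}) (fst Q), insert l (snd Q - {i}))"
proof -
  interpret word N p by (rule is_word)
  define s where "s = right_of N i"
  have sN: "s < N" using right_of_less[of i N] by (simp add: s_def)
  have s_off: "(s + a) mod N = col (2 + a)" for a
  proof -
    have "s = (l + 2) mod N" using right_of_offset[of N l 1] by (simp add: s_def)
    then show ?thesis by (simp add: mod_simps add.assoc)
  qed
  define e where "e = 2 + cut_dist s"
  have l3: "p ! l = 3"
    using not_reg descent_cases l_letter i_letter flow_front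
    by (auto simp: is_regular_def split: if_splits)
  \<comment> \<open>\<open>3 - p ! i\<close> is the class of 1 and 2 that the front seat does not have.\<close>
  obtain j where j: "j < N" "p ! j = 3 - p ! i" "cut_right p j"
    using cut_exists[of "3 - p ! i"] descent_cases(2) by force
  obtain b where b: "b < N" "col b = j" using offset_exists[OF j(1) l] by blast
  have "p ! j \<noteq> 3" "p ! j \<noteq> p ! i" using j descent_cases(2) by auto
  then have "col b \<noteq> l" "col b \<noteq> i" using b(2) l3 by metis+
  then have "b \<noteq> 0" "b \<noteq> 1" using col_eq_l_iff[OF b(1)] col_eq_i_iff[OF b(1)] by blast+
  then have b2: "2 \<le> b" by simp
  then have "cut_right p ((s + (b - 2)) mod N)" using b j by (simp only: s_off le_add_diff_inverse)
  then have "cut_dist s \<le> b - 2" by (rule cut_dist_le)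
  then have e_b: "e \<le> b" using b2 by (simp add: e_def)
  have "pulling m1 m2 m3 N Q h l e"
  proof unfold_locales
    show "\<not> (p ! right_of N l = 1 \<and> right_of N l \<in> fst Q)" using not_reg by (simp add: is_regular_def)
    show "2 \<le> e" "e < N" using e_b b by (auto simp: e_def)
    show "cut_right p (col e)" using cut_dist_cut[OF sN] unfolding s_off e_def .
    fix a assume a: "2 \<le> a" "a < e"
    then have "\<not> cut_right p ((s + (a - 2)) mod N)" using cut_dist_le[of s "a - 2"] by (auto simp: e_def)
    then show "\<not> cut_right p (col a)" using a by (simp only: s_off le_add_diff_inverse not_False_eq_True)
  qed
  moreover have "p ! col e \<noteq> p ! i" if "e = N - 1"
  proof -
    have "e = b" using that e_b b by simp
    then show ?thesis using b \<open>p ! j \<noteq> p ! i\<close> by simp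
  qed
  moreover have "mark N Q l = col e"
    using not_reg unfolding mark_def by (simp add: back_seat_eq s_off e_def s_def[symmetric])
  moreover have "set (coupe_from p s) = col ` {2..e}"
  proof -
    have "set (coupe_from p s) = col ` ((+) 2 ` {0..<Suc (cut_dist s)})"
      unfolding coupe_from_eq by (simp only: set_map set_upt image_image s_off)
    also have "(+) 2 ` {0..<Suc (cut_dist s)} = {2..e}"
      unfolding image_add_atLeastLessThan e_def by auto
    finally show ?thesis .
  qed
  then have "descent_jump N Q l = (shift_left N (col ` {2..e}) (fst Q), insert l (snd Q - {i}))"
    using not_reg by (auto simp: descent_jump_def is_regular_def Let_def s_def)
  ultimately show thesis using that by blast
qed

lemma regular_case:
  assumes "is_regular N Q l"
  shows "regular m1 m2 m3 N Q h l" "mark N Q l = l" "descent_jump N Q l = regular_jump N i Q"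
  using assms by (auto simp: mark_def is_regular_def descent_jump_def Let_def
      intro!: regular.intro regular_axioms.intro descent_axioms)

end

context regular
begin

text \<open>
  For given \<open>l\<close> a regular jump can be undone: in each row, column \<open>i\<close> was occupied before and is
  still occupied afterwards iff the particle could not move.
\<close>

lemma queue_recovered:
  "Q = ((if i \<in> fst t then fst t else insert i (fst t - {l})),
        (if i \<in> snd t then snd t else insert i (snd t - {l})))"
proof (rule prod_eqI)
  have "R = (if i \<in> R' then R' else insert i (R' - {l}))"
    if "i \<in> R" "R' = (if l \<in> R then R else insert l (R - {i}))" for R R'
    using that by (auto split: if_splits)
  from this[OF occ fst_t] this[OF front_particle snd_t]
  show "fst Q = fst ((if i \<in> fst t then fst t else insert i (fst t - {l})),
      (if i \<in> snd t then snd t else insert i (snd t - {l})))"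
    "snd Q = snd ((if i \<in> fst t then fst t else insert i (fst t - {l})),
      (if i \<in> snd t then snd t else insert i (snd t - {l})))"
    by (simp_all only: fst_conv snd_conv)
qed

lemma l_in_fst_t: "l \<in> fst t"
  unfolding fst_t by simp

lemma new_front:
  assumes t_word: "word N (bully_projection N t)"
  obtains l' where "l' < N" "bully_projection N t ! right_of N l' < bully_projection N t ! l'"
    "back_seat (coupe_from (bully_projection N t) (right_of N l')) = l"
    "bully_projection N t ! right_of N l' = 1"
proof -
  interpret t: word N "bully_projection N t" by (rule t_word)
  have "bully_projection N t ! l = 1" "bully_projection N t ! i \<noteq> 1"
    using nth_swap_right[of 0] nth_swap_right[of 1] N_ge front_1 descent_cases
    unfolding word_t by auto
  moreover from this have "cut_right (bully_projection N t) l"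
    by (simp add: cut_right_def t.length_p)
  ultimately show thesis
    using t.front_of_back_1[of l] l that by auto
qed

end

context pulling
begin

text \<open>
  For given \<open>l\<close> and \<open>e\<close> a pulling jump can be undone, since column \<open>i\<close> of row 1 was vacant and so
  no two particles have been merged by the shift.
\<close>

lemma queue_recovered_fst:
  assumes a: "a < N"
  shows "col a \<in> fst Q \<longleftrightarrow> a \<noteq> 1 \<and> (if 2 \<le> a \<and> a \<le> e then col (a - 1) \<in> fst t else col a \<in> fst t)"
proof -
  consider "a = 0" | "a = 1" | "2 \<le> a" "a \<le> e" | "e < a" by linarith
  then show ?thesis
  proof cases
    case 1
    then show ?thesis using fst_t[of 0] a e by simp
  next
    case 3
    then have "Suc (a - 1) = a" "1 \<le> a - 1" "a - 1 < e" "a - 1 < N" using e by auto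
    then show ?thesis using 3 fst_t[of "a - 1"] by simp
  next
    case 4
    then show ?thesis using fst_t[OF a] e by auto
  qed simp
qed

lemma queue_recovered_snd: "snd Q = insert i (snd t - {l})"
  by auto

lemma e_notin_fst_t: "col e \<notin> fst t"
  using fst_t[OF e(2)] by simp

lemma t_letter:
  assumes "2 \<le> a" "a < N"
  shows "bully_projection N t ! col a = p ! col a"
  using nth_swap_right[of a] assms unfolding word_t by simp

lemma t_letters_l_i: "bully_projection N t ! l = p ! i" "bully_projection N t ! i = 3"
  using nth_swap_right[of 0] nth_swap_right[of 1] N_ge l_letter unfolding word_t by simp_all

text \<open>After the jump the pulled columns and the column to their left belong to one coupe.\<close>

lemma new_coupe:
  assumes t_word: "word N (bully_projection N t)" and last: "e = N - 1 \<Longrightarrow> p ! col e \<noteq> p ! i"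
  shows "cut_right (bully_projection N t) (left_of N i)"
    "back_seat (coupe_from (bully_projection N t) i) = col e"
proof -
  interpret t: word N "bully_projection N t" by (rule t_word)
  interpret word N p by (rule is_word)
  show "cut_right (bully_projection N t) (left_of N i)"
    using t.cut_right_iff[of l 0] t_letters_l_i descent_cases by auto
  have i_off: "(i + a) mod N = col (Suc a)" for a
  proof -
    have "i = Suc l mod N" by simp
    then show ?thesis by (simp add: mod_simps del: front_simps)
  qed
  have "t.cut_dist i = e - 1"
  proof (rule t.cut_distI)
    have p_e: "p ! col e \<noteq> 3" "p ! col (Suc e) \<noteq> p ! col e"
      using cut_e cut_right_iff[of l e] by auto
    have "bully_projection N t ! col (Suc e) \<noteq> p ! col e"
    proof (cases "Suc e = N")
      case True
      then have "e = N - 1" "col (Suc e) = l" by auto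
      then show ?thesis using last t_letters_l_i by auto
    next
      case False
      then show ?thesis using p_e t_letter[of "Suc e"] e by simp
    qed
    then have "cut_right (bully_projection N t) (col e)"
      using t.cut_right_iff[of l e] t_letter[of e] e p_e by simp
    then show "cut_right (bully_projection N t) ((i + (e - 1)) mod N)"
      using e unfolding i_off by simp
    fix a assume a: "a < e - 1"
    show "\<not> cut_right (bully_projection N t) ((i + a) mod N)"
    proof (cases "a = 0")
      case True
      then show ?thesis using t.cut_right_iff[of i 0] t_letters_l_i by simp
    next
      case False
      then have "\<not> cut_right p (col (Suc a))" using no_cut[of "Suc a"] a by simp
      then show ?thesis
        unfolding i_off
        using t.cut_right_iff[of l "Suc a"] cut_right_iff[of l "Suc a"] t_letter[of "Suc a"]
          t_letter[of "Suc (Suc a)"] a e False by auto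
    qed
  qed
  then show "back_seat (coupe_from (bully_projection N t) i) = col e"
    using e unfolding t.back_seat_eq i_off by simp
qed

lemma new_front:
  assumes t_word: "word N (bully_projection N t)" and last: "e = N - 1 \<Longrightarrow> p ! col e \<noteq> p ! i"
  obtains l' where "l' < N" "bully_projection N t ! right_of N l' < bully_projection N t ! l'"
    "back_seat (coupe_from (bully_projection N t) (right_of N l')) = col e"
    "bully_projection N t ! right_of N l' = p ! col e"
proof -
  interpret t: word N "bully_projection N t" by (rule t_word)
  have "i \<in> t.starts" using new_coupe[OF t_word last] by simp
  then show thesis
    using t.front_of_start[of i] t_letters_l_i new_coupe[OF t_word last] t_letter[of e] e that by auto
qed

end


section \<open>Stationarity and lumping\<close>

context queue_type
begin

abbreviation "queue_descents Q \<equiv>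
  {l. l < N \<and> bully_projection N Q ! right_of N l < bully_projection N Q ! l}"

lemma descent_exists:
  assumes "Q \<in> queues" "l \<in> queue_descents Q"
  obtains h where "descent m1 m2 m3 N Q h l"
proof -
  obtain h where "queue_with_flow m1 m2 m3 N Q h" using queue_with_flow_exists[OF assms(1)] .
  then show thesis using that assms(2) by (simp add: descent_def descent_axioms_def)
qed

lemma word_of_queue:
  assumes "Q \<in> queues"
  shows "word N (bully_projection N Q)" "bully_projection N Q \<in> words m1 m2 m3"
    "card (covered_threes N Q) \<le> m3"
proof -
  obtain h where h: "queue_with_flow m1 m2 m3 N Q h" using queue_with_flow_exists[OF assms] .
  interpret queue_with_flow m1 m2 m3 N Q h by (rule h)
  show "word N p" "p \<in> words m1 m2 m3" "card (covered_threes N Q) \<le> m3"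
    by (fact is_word word_in_words card_covered_threes_le)+
qed

lemma descent_jump_word:
  assumes Q: "Q \<in> queues" and desc: "l \<in> queue_descents Q"
  shows "descent_jump N Q l \<in> queues"
    and "bully_projection N (descent_jump N Q l) = swap_right l (bully_projection N Q)"
proof -
  obtain h where h: "descent m1 m2 m3 N Q h l" using descent_exists[OF Q desc] .
  interpret descent m1 m2 m3 N Q h l by (rule h)
  have "descent_jump N Q l \<in> queues \<and> bully_projection N (descent_jump N Q l) = swap_right l p"
  proof (cases "is_regular N Q l")
    case True
    interpret regular m1 m2 m3 N Q h l by (rule regular_case(1)[OF True])
    show ?thesis unfolding regular_case(3)[OF True] using t_in_queues word_t by simp
  next
    case False
    obtain e where pc: "pulling m1 m2 m3 N Q h l e"
      "descent_jump N Q l = (shift_left N (col ` {2..e}) (fst Q), insert l (snd Q - {i}))"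
      using pulling_case[OF False] by metis
    interpret pulling m1 m2 m3 N Q h l e by (rule pc(1))
    show ?thesis unfolding pc(2) using t_in_queues word_t by simp
  qed
  then show "descent_jump N Q l \<in> queues"
    "bully_projection N (descent_jump N Q l) = swap_right l p" by auto
qed

text \<open>
  A pulling jump with front seat of class \<open>a\<close>, whose pulled columns end with the class \<open>c\<close>, changes
  the number of covered 3's exactly so that \<open>x a * w Q = x c * w t\<close>.
\<close>

lemma weight_balance:
  fixes x :: "nat \<Rightarrow> real"
  assumes "a = 1 \<or> a = 2" "c = 1 \<or> c = 2"
    and "card (covered_threes N t) + of_bool (a = 1) = card (covered_threes N Q) + of_bool (c = (1::nat))"
    and "card (covered_threes N t) \<le> m3" "card (covered_threes N Q) \<le> m3"
  shows "x a * coupe_weight N x m3 Q = x c * coupe_weight N x m3 t"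
proof -
  let ?k = "card (covered_threes N Q)" and ?k' = "card (covered_threes N t)"
  have shift: "x 1 ^ (m3 - k) = x 1 * x 1 ^ (m3 - Suc k)" if "Suc k \<le> m3" for k
  proof -
    have "m3 - k = Suc (m3 - Suc k)" using that by simp
    then show ?thesis by simp
  qed
  consider "a = c" "?k' = ?k" | "a = 1" "c = 2" "?k = Suc ?k'" | "a = 2" "c = 1" "?k' = Suc ?k"
    using assms(1-3) by fastforce
  then show ?thesis
  proof cases
    case 1
    then show ?thesis by (simp add: coupe_weight_def)
  next
    case 2
    then show ?thesis using shift[of ?k'] assms(5) by (simp add: coupe_weight_def Let_def)
  next
    case 3
    then show ?thesis using shift[of ?k] assms(4) by (simp add: coupe_weight_def Let_def)
  qed
qed

text \<open>
  The matched coupe is represented by the descent \<open>l'\<close> of the new word whose front seat belongs to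
  it, so that jumps and their matches are labelled in the same way.
\<close>

lemma jump_matching:
  fixes x :: "nat \<Rightarrow> real"
  assumes Q: "Q \<in> queues" and desc: "l \<in> queue_descents Q"
  defines "t \<equiv> descent_jump N Q l"
  shows "\<exists>l'\<in>queue_descents t.
      back_seat (coupe_from (bully_projection N t) (right_of N l')) = mark N Q l \<and>
      x (bully_projection N Q ! right_of N l) * coupe_weight N x m3 Q
        = x (bully_projection N t ! right_of N l') * coupe_weight N x m3 t"
proof -
  obtain h where h: "descent m1 m2 m3 N Q h l" using descent_exists[OF Q desc] .
  interpret descent m1 m2 m3 N Q h l by (rule h)
  have t: "t \<in> queues" unfolding t_def by (rule descent_jump_word(1)[OF Q desc])
  note t_word = word_of_queue(1)[OF t] and t_card = word_of_queue(3)[OF t]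
  show ?thesis
  proof (cases "is_regular N Q l")
    case True
    interpret reg: regular m1 m2 m3 N Q h l by (rule regular_case(1)[OF True])
    have t_eq: "t = reg.t" unfolding t_def by (rule regular_case(3)[OF True])
    obtain l' where l': "l' < N" "bully_projection N t ! right_of N l' < bully_projection N t ! l'"
      "back_seat (coupe_from (bully_projection N t) (right_of N l')) = l"
      "bully_projection N t ! right_of N l' = 1"
      using reg.new_front t_word unfolding t_eq by blast
    have "x 1 * coupe_weight N x m3 Q = x 1 * coupe_weight N x m3 t"
      using reg.card_covered_t by (simp add: coupe_weight_def t_eq)
    then show ?thesis
      using l' True regular_case(2)[OF True] by (intro bexI[of _ l']) (simp_all add: is_regular_def)
  next
    case False
    obtain e where pc: "pulling m1 m2 m3 N Q h l e" "e = N - 1 \<Longrightarrow> p ! col e \<noteq> p ! i"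
        "mark N Q l = col e"
      and t_eq: "t = (shift_left N (col ` {2..e}) (fst Q), insert l (snd Q - {i}))"
      using pulling_case[OF False] unfolding t_def by metis
    interpret pull: pulling m1 m2 m3 N Q h l e by (rule pc(1))
    obtain l' where l': "l' < N" "bully_projection N t ! right_of N l' < bully_projection N t ! l'"
      "back_seat (coupe_from (bully_projection N t) (right_of N l')) = col e"
      "bully_projection N t ! right_of N l' = p ! col e"
      using pull.new_front[OF _ pc(2)] t_word unfolding t_eq by blast
    have "x (p ! i) * coupe_weight N x m3 Q = x (p ! col e) * coupe_weight N x m3 t"
    proof (rule weight_balance)
      show "p ! i = 1 \<or> p ! i = 2" by (rule descent_cases(2))
      show "p ! col e = 1 \<or> p ! col e = 2"
        using pull.e_particle letter_eq_3[of "l + e"] letter_cases[of "l + e"] by auto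
    qed (use pull.card_covered_t t_card card_covered_threes_le t_eq in simp_all)
    then show ?thesis using l' pc(3) by (intro bexI[of _ l']) simp_all
  qed
qed

text \<open>
  In row 1, the column of the marked back seat is occupied after a regular jump and vacated by a
  pulling one. This decides the kind of the jump, and then the mark determines \<open>l\<close>: it is \<open>l\<close>
  itself, or it is the back seat of the coupe that starts in the column right of \<open>l\<close>.
\<close>

lemma jump_recovered:
  assumes Q: "Q \<in> queues" "l \<in> queue_descents Q" and Q': "Q' \<in> queues" "l' \<in> queue_descents Q'"
    and t_eq: "descent_jump N Q l = descent_jump N Q' l'" and mark_eq: "mark N Q l = mark N Q' l'"
  shows "Q = Q' \<and> l = l'"
proof -
  define t where "t = descent_jump N Q l"
  have t_word: "word N (bully_projection N t)"
    unfolding t_def by (rule word_of_queue(1)[OF descent_jump_word(1)[OF Q]])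
  obtain h where h: "descent m1 m2 m3 N Q h l" using descent_exists[OF Q] .
  obtain h' where h': "descent m1 m2 m3 N Q' h' l'" using descent_exists[OF Q'] .
  interpret D: descent m1 m2 m3 N Q h l by (rule h)
  interpret D': descent m1 m2 m3 N Q' h' l' by (rule h')
  have reg_mark: "is_regular N Q l \<longleftrightarrow> mark N Q l \<in> fst t"
    if Q: "Q \<in> queues" "l \<in> queue_descents Q" and t: "t = descent_jump N Q l" for Q l
  proof -
    obtain h where h: "descent m1 m2 m3 N Q h l" using descent_exists[OF Q] .
    interpret descent m1 m2 m3 N Q h l by (rule h)
    show ?thesis
    proof (cases "is_regular N Q l")
      case True
      interpret regular m1 m2 m3 N Q h l by (rule regular_case(1)[OF True])
      show ?thesis using l_in_fst_t True unfolding t regular_case(2,3)[OF True] by simp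
    next
      case False
      obtain e where pc: "pulling m1 m2 m3 N Q h l e" "mark N Q l = col e"
        "descent_jump N Q l = (shift_left N (col ` {2..e}) (fst Q), insert l (snd Q - {i}))"
        using pulling_case[OF False] by metis
      interpret pulling m1 m2 m3 N Q h l e by (rule pc(1))
      show ?thesis using e_notin_fst_t False unfolding t pc(2,3) by simp
    qed
  qed
  show ?thesis
  proof (cases "is_regular N Q l")
    case True
    then have True': "is_regular N Q' l'"
      using reg_mark[OF Q t_def] reg_mark[OF Q'] t_eq mark_eq by (simp add: t_def)
    have "l = l'" using mark_eq D.regular_case(2)[OF True] D'.regular_case(2)[OF True'] by simp
    interpret R: regular m1 m2 m3 N Q h l by (rule D.regular_case(1)[OF True])
    interpret R': regular m1 m2 m3 N Q' h' l' by (rule D'.regular_case(1)[OF True'])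
    have "R.t = R'.t" using t_eq unfolding D.regular_case(3)[OF True] D'.regular_case(3)[OF True'] .
    moreover have "D.i = D'.i" using \<open>l = l'\<close> by simp
    ultimately show ?thesis
      using R.queue_recovered R'.queue_recovered \<open>l = l'\<close> by (metis (no_types))
  next
    case False
    then have False': "\<not> is_regular N Q' l'"
      using reg_mark[OF Q t_def] reg_mark[OF Q'] t_eq mark_eq by (simp add: t_def)
    obtain e where pc: "pulling m1 m2 m3 N Q h l e" "e = N - 1 \<Longrightarrow> D.p ! D.col e \<noteq> D.p ! D.i"
        "mark N Q l = D.col e"
        "descent_jump N Q l = (shift_left N (D.col ` {2..e}) (fst Q), insert l (snd Q - {D.i}))"
      using D.pulling_case[OF False] by metis
    obtain e' where pc': "pulling m1 m2 m3 N Q' h' l' e'" "e' = N - 1 \<Longrightarrow> D'.p ! D'.col e' \<noteq> D'.p ! D'.i"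
        "mark N Q' l' = D'.col e'"
        "descent_jump N Q' l' = (shift_left N (D'.col ` {2..e'}) (fst Q'), insert l' (snd Q' - {D'.i}))"
      using D'.pulling_case[OF False'] by metis
    interpret P: pulling m1 m2 m3 N Q h l e by (rule pc(1))
    interpret P': pulling m1 m2 m3 N Q' h' l' e' by (rule pc'(1))
    interpret t: word N "bully_projection N t" by (rule t_word)
    have t1: "t = P.t" unfolding t_def by (rule pc(4))
    have t2: "t = P'.t" unfolding t_def t_eq by (rule pc'(4))
    have new: "cut_right (bully_projection N t) (left_of N D.i)"
      "back_seat (coupe_from (bully_projection N t) D.i) = D.col e"
      using P.new_coupe[folded t1] t_word pc(2) by blast+
    have new': "cut_right (bully_projection N t) (left_of N D'.i)"
      "back_seat (coupe_from (bully_projection N t) D'.i) = D'.col e'"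
      using P'.new_coupe[folded t2] t_word pc'(2) by blast+
    have col_eq: "D.col e = D'.col e'" using mark_eq unfolding pc(3) pc'(3) .
    have ii: "D.i = D'.i"
    proof (rule t.back_inj)
      show "D.i \<in> t.starts" "D'.i \<in> t.starts" using new(1) new'(1) by simp_all
      show "back_seat (coupe_from (bully_projection N t) D.i) = back_seat (coupe_from (bully_projection N t) D'.i)"
        unfolding new(2) new'(2) by (rule col_eq)
    qed
    then have ll: "l = l'" by (metis D.front_simps(3) D'.front_simps(3))
    have ee: "e = e'" using col_eq unfolding ll by (rule offset_inj) (fact P.e(2) P'.e(2))+
    have "fst Q = fst Q'"
    proof -
      have "j \<in> fst Q \<longleftrightarrow> j \<in> fst Q'" if j: "j < N" for j
      proof -
        obtain a where a: "a < N" "(l + a) mod N = j" using offset_exists[OF j D.l] by blast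
        show ?thesis
          using P.queue_recovered_fst[OF a(1), folded t1] P'.queue_recovered_fst[OF a(1), folded t2]
          unfolding ll[symmetric] ee[symmetric] a(2) by (simp only:)
      qed
      then show ?thesis using queuesD(1)[OF Q(1)] queuesD(1)[OF Q'(1)] by blast
    qed
    moreover have "snd Q = snd Q'"
      using P.queue_recovered_snd[folded t1] P'.queue_recovered_snd[folded t2]
      unfolding ll ii by (simp only:)
    ultimately show ?thesis using ll by (simp add: prod_eq_iff)
  qed
qed

lemma coupe_rate_descents:
  assumes "Q \<in> queues"
  shows "coupe_rate N x Q Q' = (\<Sum>l | l \<in> queue_descents Q \<and> descent_jump N Q l = Q'.
    x (bully_projection N Q ! right_of N l))"
  by (rule coupe_rate_eq[OF word_of_queue(1)[OF assms]])

lemma stationary_coupe_weight: "stationary_weight queues (coupe_rate N x) (coupe_weight N x m3)"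
proof (rule stationary_weight_if_matching[where E = queue_descents and tgt = "descent_jump N"
      and \<rho> = "\<lambda>Q l. x (bully_projection N Q ! right_of N l)" and b = "mark N"
      and \<beta> = "\<lambda>t l. back_seat (coupe_from (bully_projection N t) (right_of N l))"])
  fix Q l assume "Q \<in> queues" "l \<in> queue_descents Q"
  then show "descent_jump N Q l \<in> queues"
    "\<exists>l'\<in>queue_descents (descent_jump N Q l).
      back_seat (coupe_from (bully_projection N (descent_jump N Q l)) (right_of N l')) = mark N Q l \<and>
      x (bully_projection N Q ! right_of N l) * coupe_weight N x m3 Q
        = x (bully_projection N (descent_jump N Q l) ! right_of N l')
          * coupe_weight N x m3 (descent_jump N Q l)"
    by (fact descent_jump_word(1), fact jump_matching)
next
  fix Q l Q' l' assume "Q \<in> queues" "l \<in> queue_descents Q" "Q' \<in> queues" "l' \<in> queue_descents Q'"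
    "descent_jump N Q l = descent_jump N Q' l'" "mark N Q l = mark N Q' l'"
  then show "Q = Q' \<and> l = l'" by (rule jump_recovered)
qed (simp_all add: finite_queues coupe_rate_descents)

lemma nonempty_queues: "queues \<noteq> {}"
proof -
  have "({..<m1}, {..<m1 + m2}) \<in> queues" by (auto simp: multiline_queues_def)
  then show ?thesis by blast
qed

lemma letter_pos:
  fixes x :: "nat \<Rightarrow> real"
  assumes x: "0 < x 1" "0 < x 2" and Q: "Q \<in> queues" and desc: "l \<in> queue_descents Q"
  shows "0 < x (bully_projection N Q ! right_of N l)"
proof -
  obtain h where h: "descent m1 m2 m3 N Q h l" using descent_exists[OF Q desc] .
  interpret descent m1 m2 m3 N Q h l by (rule h)
  show ?thesis using descent_cases(2) x by auto
qed

lemma markov_chain_coupes: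
  assumes "0 < x 1" "0 < x 2"
  shows "markov_chain queues (coupe_rate N x)"
  unfolding markov_chain_def
proof (intro conjI ballI allI impI)
  fix s t assume s: "s \<in> queues"
  show "0 \<le> coupe_rate N x s t"
    unfolding coupe_rate_descents[OF s] using letter_pos[of x s] assms s
    by (intro sum_nonneg) (auto intro: less_imp_le)
  assume "t \<notin> queues"
  then have "{l. l \<in> queue_descents s \<and> descent_jump N s l = t} = {}"
    using descent_jump_word(1)[OF s] by blast
  then show "coupe_rate N x s t = 0" unfolding coupe_rate_descents[OF s] by (simp only: sum.empty)
qed (simp_all add: finite_queues nonempty_queues)

text \<open>
  The jumps of a queue correspond to the descents of its word, and so do the transitions of the
  exclusion process from this word; corresponding transitions have equal rates.
\<close>

lemma coupe_chain_lumps: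
  "lumps queues (coupe_rate N x) (bully_projection N) (words m1 m2 m3) (exclusion_rate x)"
  unfolding lumps_def
proof (intro conjI ballI impI)
  show "bully_projection N ` queues \<subseteq> words m1 m2 m3" using word_of_queue(2) by auto
next
  fix s u assume s: "s \<in> queues"
  let ?D = "queue_descents s" and ?x = "\<lambda>l. x (bully_projection N s ! right_of N l)"
  have "(\<Sum>s' | s' \<in> queues \<and> bully_projection N s' = u. coupe_rate N x s s')
      = (\<Sum>s' \<in> {s' \<in> queues. bully_projection N s' = u}.
          \<Sum>l \<in> {l \<in> {l \<in> ?D. swap_right l (bully_projection N s) = u}. descent_jump N s l = s'}. ?x l)"
    unfolding coupe_rate_descents[OF s]
  proof (rule sum.cong[OF refl], rule sum.cong[OF _ refl])
    fix s' assume "s' \<in> {s' \<in> queues. bully_projection N s' = u}"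
    then have "swap_right l (bully_projection N s) = u" if "l \<in> ?D" "descent_jump N s l = s'" for l
      using descent_jump_word(2)[OF s that(1)] that(2) by simp
    then show "{l. l \<in> ?D \<and> descent_jump N s l = s'}
        = {l \<in> {l \<in> ?D. swap_right l (bully_projection N s) = u}. descent_jump N s l = s'}"
      by blast
  qed
  also have "\<dots> = (\<Sum>l \<in> {l \<in> ?D. swap_right l (bully_projection N s) = u}. ?x l)"
  proof (rule sum.group)
    show "descent_jump N s ` {l \<in> ?D. swap_right l (bully_projection N s) = u}
        \<subseteq> {s' \<in> queues. bully_projection N s' = u}"
      using descent_jump_word[OF s] by blast
  qed (simp_all add: finite_queues)
  also have "\<dots> = exclusion_rate x (bully_projection N s) u"
    using exclusion_rate_eq[OF word.length_p[OF word_of_queue(1)[OF s]]] by simp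
  finally show "(\<Sum>s' | s' \<in> queues \<and> bully_projection N s' = u. coupe_rate N x s s')
      = exclusion_rate x (bully_projection N s) u" .
qed

end


section \<open>Irreducibility\<close>

context queue_type
begin

lemma word_sorted_unique:
  assumes "p \<in> words m1 m2 m3" "q \<in> words m1 m2 m3" "sorted p" "sorted q"
  shows "p = q"
proof -
  have "mset p = mset q"
  proof (rule multiset_eqI)
    fix a
    have "count_list p a = count_list q a"
    proof (cases "a \<in> {1, 2, 3}")
      case True
      then show ?thesis using assms(1,2) by (auto simp: words_def)
    next
      case False
      then have "a \<notin> set p" "a \<notin> set q" using assms(1,2) by (auto simp: words_def)
      then show ?thesis by (metis count_notin)
    qed
    then show "count (mset p) a = count (mset q) a" by (simp add: count_mset)
  qed
  then show ?thesis using assms(3,4) properties_for_sort by metis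
qed

lemma rate_pos_iff:
  assumes x: "0 < x 1" "0 < x 2" and s: "s \<in> queues"
  shows "coupe_rate N x s t \<noteq> 0 \<longleftrightarrow> (\<exists>l\<in>queue_descents s. descent_jump N s l = t)"
proof
  assume nz: "coupe_rate N x s t \<noteq> 0"
  show "\<exists>l\<in>queue_descents s. descent_jump N s l = t"
  proof (rule ccontr)
    assume "\<not> ?thesis"
    then have "{l. l \<in> queue_descents s \<and> descent_jump N s l = t} = {}" by blast
    then show False using nz unfolding coupe_rate_descents[OF s] by (simp only: sum.empty)
  qed
next
  assume "\<exists>l\<in>queue_descents s. descent_jump N s l = t"
  then have ne: "{l. l \<in> queue_descents s \<and> descent_jump N s l = t} \<noteq> {}" by blast
  have "0 < coupe_rate N x s t"
    unfolding coupe_rate_descents[OF s]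
    by (rule sum_pos) (use ne letter_pos[where x = x, OF x s] in auto)
  then show "coupe_rate N x s t \<noteq> 0" by simp
qed

text \<open>
  A jump at a descent \<open>l < N - 1\<close> moves the larger letter to the right and so increases
  \<open>\<Sum>j<N. j * p ! j\<close>. A queue that maximizes this sum has no such descent.
\<close>

lemma closed_contains_sorted:
  assumes Z: "Z \<subseteq> queues" "Z \<noteq> {}"
    and closed: "\<And>s l. s \<in> Z \<Longrightarrow> l \<in> queue_descents s \<Longrightarrow> descent_jump N s l \<in> Z"
  obtains s where "s \<in> Z" "sorted (bully_projection N s)"
proof -
  define f where "f s = (\<Sum>j<N. j * bully_projection N s ! j)" for s
  have "finite Z" using Z finite_queues finite_subset by blast
  then have "Max (f ` Z) \<in> f ` Z" using Z by (intro Max_in) auto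
  then obtain s where s: "s \<in> Z" "f s = Max (f ` Z)" by auto
  have max: "f t \<le> f s" if "t \<in> Z" for t
    using that \<open>finite Z\<close> s(2) by simp
  interpret word N "bully_projection N s" using word_of_queue(1) Z s by blast
  define p where "p = bully_projection N s"
  have len: "length p = N" using length_p by (simp add: p_def)
  have "sorted p"
  proof (rule ccontr)
    assume "\<not> sorted p"
    then obtain k where k: "Suc k < N" "p ! Suc k < p ! k"
      by (auto simp: sorted_iff_nth_Suc len not_le)
    have right: "right_of N k = Suc k" using k by (simp add: right_of_def)
    have desc: "k \<in> queue_descents s" using k right by (simp add: p_def)
    define t where "t = descent_jump N s k"
    have t: "t \<in> Z" unfolding t_def by (rule closed[OF s(1) desc])
    define p' where "p' = bully_projection N t"
    have "p' = swap_right k p"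
      unfolding p'_def t_def p_def using descent_jump_word(2) desc Z s by blast
    then have p': "p' ! j = (if j = k then p ! Suc k else if j = Suc k then p ! k else p ! j)"
      if "j < N" for j
      using that k by (auto simp: swap_right_def Let_def len right nth_list_update)
    have split: "(\<Sum>j<N. g j) = g k + (g (Suc k) + (\<Sum>j\<in>{..<N} - {k} - {Suc k}. g j))"
      for g :: "nat \<Rightarrow> nat"
      using k by (subst sum.remove[of _ k]) (auto simp: sum.remove[of "{..<N} - {k}" "Suc k"])
    have rest: "(\<Sum>j\<in>{..<N} - {k} - {Suc k}. j * p' ! j) = (\<Sum>j\<in>{..<N} - {k} - {Suc k}. j * p ! j)"
      by (intro sum.cong) (auto simp: p')
    have "f t = k * p ! Suc k + (Suc k * p ! k + (\<Sum>j\<in>{..<N} - {k} - {Suc k}. j * p ! j))"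
      unfolding f_def p'_def[symmetric] split rest using k by (simp add: p')
    moreover have "f s = k * p ! k + (Suc k * p ! Suc k + (\<Sum>j\<in>{..<N} - {k} - {Suc k}. j * p ! j))"
      unfolding f_def p_def[symmetric] split by simp
    ultimately have "f s < f t" using k by simp
    then show False using max[OF t] by simp
  qed
  then show thesis using that s by (simp add: p_def)
qed

text \<open>
  The word of this queue is \<open>3\<dots>3 2\<dots>2 1\<dots>1\<close>, and no other queue has this word: no path crosses a
  2, so the first 1 is directly below a particle of row 1, whose path ends there; therefore the
  second 1 is directly below a particle of row 1, and so on.
\<close>

definition rigid_queue :: mlq where
  "rigid_queue = ({m2 + m3..<N}, {m3..<N})"

lemma rigid_queue_in_queues: "rigid_queue \<in> queues"
  unfolding rigid_queue_def by (auto simp: multiline_queues_def N_def)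

lemma rigid_queue_letters:
  "k < N \<Longrightarrow> bully_projection N rigid_queue ! k = (if k < m3 then 3 else if k < m2 + m3 then 2 else 1)"
proof -
  define h where "h k = (of_bool (m2 + m3 \<le> k mod N) :: nat)" for k
  have m: "m2 + m3 < N" using m_pos by (simp add: N_def)
  have "flow N rigid_queue h"
    unfolding flow_def
  proof (intro conjI allI)
    fix k
    show "h (k + N) = h k" by (simp add: h_def)
    have "k mod N < N" using m by simp
    then show "h (Suc k) = h k - of_bool (k mod N \<in> snd rigid_queue)
        + of_bool (Suc k mod N \<in> fst rigid_queue)"
      by (auto simp: h_def rigid_queue_def)
  qed
  then interpret queue_with_flow m1 m2 m3 N rigid_queue h
    by unfold_locales (use rigid_queue_in_queues in auto)
  show "k < N \<Longrightarrow> p ! k = (if k < m3 then 3 else if k < m2 + m3 then 2 else 1)"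
    using letter_eq[of k] by (auto simp: h_def rigid_queue_def)
qed

lemma rigid_queue_unique:
  assumes Q: "Q \<in> queues" and word_eq: "bully_projection N Q = bully_projection N rigid_queue"
  shows "Q = rigid_queue"
proof -
  obtain h where h: "queue_with_flow m1 m2 m3 N Q h" using queue_with_flow_exists[OF Q] .
  interpret queue_with_flow m1 m2 m3 N Q h by (rule h)
  have letter: "p ! k = (if k < m3 then 3 else if k < m2 + m3 then 2 else 1)" if "k < N" for k
    using rigid_queue_letters[OF that] word_eq by simp
  have snd: "j \<in> snd Q \<longleftrightarrow> m3 \<le> j" if "j < N" for j
    using letter[OF that] letter_eq_3[of j] that by (auto split: if_splits)
  define c where "c = m2 + m3 - 1"
  have c: "c < N" "m3 \<le> c" "c < m2 + m3" "Suc c = m2 + m3" "Suc c < N"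
    using m_pos by (auto simp: c_def N_def)
  have "h c = 0" using letter[OF c(1)] letter_eq_2[of c] c by auto
  have start: "c + Suc a \<in> fst Q \<and> h (c + Suc a) = 1" if "h (c + a) \<le> 1" "c + Suc a < N" for a
  proof -
    have "c + a \<in> snd Q" using snd[of "c + a"] that c by simp
    then have "h (c + Suc a) = of_bool (c + Suc a \<in> fst Q)"
      using flow_Suc[OF h, of "c + a"] that by simp
    moreover have "p ! (c + Suc a) = 1" using letter[OF that(2)] c by simp
    then have "0 < h (c + Suc a)" using letter_eq_1[of "c + Suc a"] that by simp
    ultimately show ?thesis by (auto split: if_splits)
  qed
  have "c + a < N \<longrightarrow> h (c + a) \<le> 1" for a
  proof (induction a)
    case (Suc a)
    then show ?case using start[of a] by auto
  qed (simp add: \<open>h c = 0\<close>)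
  then have row1: "c + Suc a \<in> fst Q" if "c + Suc a < N" for a
    using start[of a] that by simp
  have "{m2 + m3..<N} \<subseteq> fst Q"
  proof
    fix j assume j: "j \<in> {m2 + m3..<N}"
    then have "Suc c \<le> j" using c by simp
    then have "c + Suc (j - Suc c) = j" by simp
    then show "j \<in> fst Q" using row1[of "j - Suc c"] j by simp
  qed
  moreover have "card {m2 + m3..<N} = card (fst Q)" using queuesD[OF Q] by (simp add: N_def)
  ultimately have "fst Q = {m2 + m3..<N}"
    using card_subset_eq[of "fst Q" "{m2 + m3..<N}"] queuesD[OF Q] by simp
  moreover have "snd Q = {m3..<N}" using snd columns by auto
  ultimately show ?thesis by (simp add: rigid_queue_def prod_eq_iff)
qed

text \<open>
  The queues with a word in \<open>B ` Z\<close> form a set \<open>Y\<close> that is closed as well, because the jumps of a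
  queue act on its word alone. In equilibrium the complement of \<open>Y\<close> is then closed, too. Both would
  contain a queue over the sorted word, so the complement is empty, and \<open>3\<dots>3 2\<dots>2 1\<dots>1\<close> is the word
  of some queue in \<open>Z\<close>.
\<close>

lemma closed_contains_rigid_queue:
  assumes x: "0 < x 1" "0 < x 2"
    and Z: "Z \<subseteq> queues" "Z \<noteq> {}"
    and no_rate: "\<And>s t. s \<in> Z \<Longrightarrow> t \<in> queues - Z \<Longrightarrow> coupe_rate N x s t = 0"
  shows "rigid_queue \<in> Z"
proof -
  let ?B = "bully_projection N"
  have jump_closed: "descent_jump N s l \<in> Z'"
    if "Z' \<subseteq> queues" "\<And>s t. s \<in> Z' \<Longrightarrow> t \<in> queues - Z' \<Longrightarrow> coupe_rate N x s t = 0"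
      "s \<in> Z'" "l \<in> queue_descents s" for Z' s l
    using that rate_pos_iff[where x = x, OF x] descent_jump_word(1)[of s l] by blast
  define Y where "Y = {s \<in> queues. ?B s \<in> ?B ` Z}"
  have Y_closed: "coupe_rate N x s t = 0" if s: "s \<in> Y" and t: "t \<in> queues - Y" for s t
  proof (rule ccontr)
    assume "coupe_rate N x s t \<noteq> 0"
    then obtain l where l: "l \<in> queue_descents s" "descent_jump N s l = t"
      using rate_pos_iff[where x = x, OF x, of s t] s by (auto simp: Y_def)
    obtain s' where s': "s' \<in> Z" "?B s' = ?B s" using s by (auto simp: Y_def)
    then have l': "l \<in> queue_descents s'" using l by simp
    have "descent_jump N s' l \<in> Z" using jump_closed[OF Z(1) no_rate s'(1) l'] .
    moreover have "?B (descent_jump N s' l) = ?B t"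
      using descent_jump_word(2)[of s' l] descent_jump_word(2)[of s l] s s' l l' Z
      by (auto simp: Y_def)
    ultimately show False using t by (auto simp: Y_def intro: rev_image_eqI)
  qed
  have pos: "0 < coupe_weight N x m3 s" for s
    using x by (simp add: coupe_weight_def Let_def)
  have compl_closed: "coupe_rate N x s t = 0" if "s \<in> queues - Y" "t \<in> queues - (queues - Y)" for s t
    by (rule forward_closed_imp_backward_closed[OF markov_chain_coupes[where x = x, OF x]
          stationary_coupe_weight pos, of Y]) (use that Y_closed in \<open>auto simp: Y_def\<close>)
  have "queues - Y = {}"
  proof (rule ccontr)
    assume ne: "queues - Y \<noteq> {}"
    have compl_jump: "descent_jump N s l \<in> queues - Y"
      if "s \<in> queues - Y" "l \<in> queue_descents s" for s l
      using Diff_subset compl_closed that by (rule jump_closed)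
    have Z_jump: "descent_jump N s l \<in> Z" if "s \<in> Z" "l \<in> queue_descents s" for s l
      using Z(1) no_rate that by (rule jump_closed)
    obtain s where s: "s \<in> queues - Y" "sorted (?B s)"
      using closed_contains_sorted[OF Diff_subset ne compl_jump] by metis
    obtain s' where s': "s' \<in> Z" "sorted (?B s')"
      using closed_contains_sorted[OF Z Z_jump] by metis
    have "?B s = ?B s'"
      using s s' Z by (intro word_sorted_unique word_of_queue(2)) auto
    then show False using s s' by (auto simp: Y_def)
  qed
  then have "rigid_queue \<in> Y" using rigid_queue_in_queues by blast
  then obtain s where "s \<in> Z" "?B s = ?B rigid_queue" by (auto simp: Y_def)
  then show ?thesis using rigid_queue_unique Z by blast
qed

end

section \<open>The theorem\<close>

theorem theorem5p5:
  fixes m1 m2 m3 N :: nat and x :: "nat \<Rightarrow> real"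
  assumes "m1 > 0" "m2 > 0" "m3 > 0"
    and "N = m1 + m2 + m3"
    and "x 1 > 0" "x 2 > 0"
  shows
    "markov_chain (multiline_queues m1 m2 m3) (coupe_rate N x) \<and>
     stationary_weight (multiline_queues m1 m2 m3) (coupe_rate N x) (coupe_weight N x m3) \<and>
     (\<forall>v. stationary_weight (multiline_queues m1 m2 m3) (coupe_rate N x) v \<longrightarrow>
        (\<exists>c. \<forall>Q\<in>multiline_queues m1 m2 m3. v Q = c * coupe_weight N x m3 Q)) \<and>
     lumps (multiline_queues m1 m2 m3) (coupe_rate N x) (bully_projection N)
       (words m1 m2 m3) (exclusion_rate x)"
proof -
  interpret queue_type m1 m2 m3 N by unfold_locales (fact assms)+
  note chain = markov_chain_coupes[where x = x, OF assms(5,6)]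
  have pos: "0 < coupe_weight N x m3 Q" for Q
    using assms by (simp add: coupe_weight_def Let_def)
  have "\<exists>c. \<forall>Q\<in>queues. v Q = c * coupe_weight N x m3 Q"
    if "stationary_weight queues (coupe_rate N x) v" for v
    using chain stationary_coupe_weight pos closed_contains_rigid_queue[where x = x, OF assms(5,6)] that
    by (rule stationary_weight_unique)
  then show ?thesis using chain stationary_coupe_weight coupe_chain_lumps by blast
qed

end
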